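(* Let $\Lambda$ and $H$ be countable (discrete) groups. (i) When $H$ is finite, we have isomorphisms of topological groups $$\mathrm{Bohr}(\Lambda\wr H)\cong\Big(\bigoplus_{h\in H}\mathrm{Bohr}(\Lambda)\Big)\rtimes\mathrm{Bohr}(H)\quad\text{and}\quad \mathrm{Prof}(\Lambda\wr H)\cong\Big(\bigoplus_{h\in H}\mathrm{Prof}(\Lambda)\Big)\rtimes\mathrm{Prof}(H).$$ (ii) When $H$ is infinite, the quotient map $\Lambda\wr H\to\Lambda^{\mathrm{Ab}}\wr H$ induces isomorphisms of topological groups $$\mathrm{Bohr}(\Lambda\wr H)\cong\mathrm{Bohr}(\Lambda^{\mathrm{Ab}}\wr H)\quad\text{and}\quad\mathrm{Prof}(\Lambda\wr H)\cong\mathrm{Prof}(\Lambda^{\mathrm{Ab}}\wr H).$$ In particular, if $\Lambda$ is perfect (that is, $\Lambda=[\Lambda,\Lambda]$), the quotient map $\Lambda\wr H\to H$ induces isomorphisms $$\mathrm{Bohr}(\Lambda\wr H)\cong\mathrm{Bohr}(H)\quad\text{and}\quad\mathrm{Prof}(\Lambda\wr H)\cong\mathrm{Prof}(H).$$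
   Context: Compact groups are Hausdorff. A Bohr compactification (respectively, a profinite completion) of a topological group $G$ is a pair $(\mathrm{Bohr}(G),\beta_G)$ (respectively, $(\mathrm{Prof}(G),\alpha_G)$) consisting of a compact (respectively, profinite) group and a continuous homomorphism from $G$ to it with dense image, such that every continuous homomorphism from $G$ to a compact (respectively, profinite) group $L$ factors through it via a continuous homomorphism. They exist and are unique up to isomorphism. A continuous homomorphism $f:G_1\to G_2$ induces continuous homomorphisms $\mathrm{Bohr}(f):\mathrm{Bohr}(G_1)\to\mathrm{Bohr}(G_2)$ and $\mathrm{Prof}(f):\mathrm{Prof}(G_1)\to\mathrm{Prof}(G_2)$ determined by $\mathrm{Bohr}(f)\circ\beta_{G_1}=\beta_{G_2}\circ f$ and $\mathrm{Prof}(f)\circ\alpha_{G_1}=\alpha_{G_2}\circ f$; "$f$ induces isomorphisms" means that these maps are topological isomorphisms. The wreath product $\Lambda\wr H$ is the semi-direct product $(\bigoplus_{h\in H}\Lambda)\rtimes H$, where $\bigoplus_{h\in H}\Lambda$ is the group of finitely supported families and $H$ acts by shifting the indices; it is viewed as a discrete group. $\Lambda^{\mathrm{Ab}}=\Lambda/[\Lambda,\Lambda]$ is the abelianization, and the quotient map $\Lambda\wr H\to\Lambda^{\mathrm{Ab}}\wr H$ is $((\lambda_a)_{a\in H},h)\mapsto((\lambda_a[\Lambda,\Lambda])_{a\in H},h)$. In (i), since $H$ is finite, $\mathrm{Bohr}(H)=\mathrm{Prof}(H)=H$, and the action on the direct sum is by shifting the indices. *)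

theory Defs
  imports "HOL-Analysis.Analysis" "HOL-Algebra.Algebra"
begin

definition topological_group :: "('a, 'm) monoid_scheme \<Rightarrow> 'a topology \<Rightarrow> bool" where
  "topological_group G T \<longleftrightarrow>
     group G \<and> topspace T = carrier G \<and>
     continuous_map (prod_topology T T) T (\<lambda>(x, y). x \<otimes>\<^bsub>G\<^esub> y) \<and>
     continuous_map T T (\<lambda>x. inv\<^bsub>G\<^esub> x)"

definition compact_group :: "('a, 'm) monoid_scheme \<Rightarrow> 'a topology \<Rightarrow> bool" where
  "compact_group G T \<longleftrightarrow> topological_group G T \<and> compact_space T \<and> Hausdorff_space T"

definition totally_disconnected_space :: "'a topology \<Rightarrow> bool" where
  "totally_disconnected_space T \<longleftrightarrow> (\<forall>S. connectedin T S \<longrightarrow> (\<exists>x. S \<subseteq> {x}))"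

definition profinite_group :: "('a, 'm) monoid_scheme \<Rightarrow> 'a topology \<Rightarrow> bool" where
  "profinite_group G T \<longleftrightarrow> compact_group G T \<and> totally_disconnected_space T"

definition continuous_hom ::
  "('a, 'm) monoid_scheme \<Rightarrow> 'a topology \<Rightarrow> ('b, 'n) monoid_scheme \<Rightarrow> 'b topology \<Rightarrow> ('a \<Rightarrow> 'b) \<Rightarrow> bool"
  where "continuous_hom G T K U f \<longleftrightarrow> f \<in> hom G K \<and> continuous_map T U f"

definition topological_iso ::
  "('a, 'm) monoid_scheme \<Rightarrow> 'a topology \<Rightarrow> ('b, 'n) monoid_scheme \<Rightarrow> 'b topology \<Rightarrow> ('a \<Rightarrow> 'b) \<Rightarrow> bool"
  where "topological_iso G T K U f \<longleftrightarrow> f \<in> Group.iso G K \<and> homeomorphic_map T U f"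

text \<open>
  The universal properties below test against compact (profinite) groups \<open>L\<close> with carrier in the
  type \<open>'g set set\<close>, since HOL cannot quantify over types inside a formula. This loses nothing:
  the closure of the image of \<open>G\<close> in a Hausdorff group embeds in \<open>'g set set\<close>. The lemmas
  \<open>bohr_compactification_universal\<close> and \<open>profinite_completion_universal\<close> give the factorization
  for compact (profinite) groups over an arbitrary type; existence is shown in
  \<open>bohr_compactification_exists\<close> and \<open>profinite_completion_exists\<close>.
\<close>

definition bohr_compactification ::
  "('g, 'm) monoid_scheme \<Rightarrow> 'g topology \<Rightarrow> ('k, 'n) monoid_scheme \<Rightarrow> 'k topology \<Rightarrow> ('g \<Rightarrow> 'k) \<Rightarrow> bool"
  where
  "bohr_compactification G T K U \<beta> \<longleftrightarrow>
     topological_group G T \<and> compact_group K U \<and> continuous_hom G T K U \<beta> \<and>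
     U closure_of (\<beta> ` carrier G) = carrier K \<and>
     (\<forall>(L :: 'g set set monoid) V f. compact_group L V \<and> continuous_hom G T L V f \<longrightarrow>
        (\<exists>\<phi>. continuous_hom K U L V \<phi> \<and> (\<forall>g\<in>carrier G. \<phi> (\<beta> g) = f g)))"

definition profinite_completion ::
  "('g, 'm) monoid_scheme \<Rightarrow> 'g topology \<Rightarrow> ('k, 'n) monoid_scheme \<Rightarrow> 'k topology \<Rightarrow> ('g \<Rightarrow> 'k) \<Rightarrow> bool"
  where
  "profinite_completion G T K U \<alpha> \<longleftrightarrow>
     topological_group G T \<and> profinite_group K U \<and> continuous_hom G T K U \<alpha> \<and>
     U closure_of (\<alpha> ` carrier G) = carrier K \<and>
     (\<forall>(L :: 'g set set monoid) V f. profinite_group L V \<and> continuous_hom G T L V f \<longrightarrow>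
        (\<exists>\<phi>. continuous_hom K U L V \<phi> \<and> (\<forall>g\<in>carrier G. \<phi> (\<alpha> g) = f g)))"

text \<open>
  \<open>\<phi>\<close> is the map \<open>Bohr(f)\<close> (or \<open>Prof(f)\<close>) between the completions \<open>(K\<^sub>1, \<beta>\<^sub>1)\<close> of \<open>G\<close> and
  \<open>(K\<^sub>2, \<beta>\<^sub>2)\<close> of the target of \<open>f\<close>.
\<close>

definition induced_map ::
  "('g, 'm) monoid_scheme \<Rightarrow> ('g \<Rightarrow> 'h) \<Rightarrow>
   ('k, 'n) monoid_scheme \<Rightarrow> 'k topology \<Rightarrow> ('g \<Rightarrow> 'k) \<Rightarrow>
   ('l, 'p) monoid_scheme \<Rightarrow> 'l topology \<Rightarrow> ('h \<Rightarrow> 'l) \<Rightarrow> ('k \<Rightarrow> 'l) \<Rightarrow> bool"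
  where
  "induced_map G f K\<^sub>1 U\<^sub>1 \<beta>\<^sub>1 K\<^sub>2 U\<^sub>2 \<beta>\<^sub>2 \<phi> \<longleftrightarrow>
     continuous_hom K\<^sub>1 U\<^sub>1 K\<^sub>2 U\<^sub>2 \<phi> \<and> (\<forall>g\<in>carrier G. \<phi> (\<beta>\<^sub>1 g) = \<beta>\<^sub>2 (f g))"

definition semidirect_product ::
  "('n, 'p) monoid_scheme \<Rightarrow> ('h, 'q) monoid_scheme \<Rightarrow> ('h \<Rightarrow> 'n \<Rightarrow> 'n) \<Rightarrow> ('n \<times> 'h) monoid"
  where
  "semidirect_product N H \<theta> =
     \<lparr>carrier = carrier N \<times> carrier H,
      mult = (\<lambda>(x, h) (y, k). (x \<otimes>\<^bsub>N\<^esub> \<theta> h y, h \<otimes>\<^bsub>H\<^esub> k)),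
      one = (\<one>\<^bsub>N\<^esub>, \<one>\<^bsub>H\<^esub>)\<rparr>"

text \<open>\<open>sum_group\<close> uses extensional functions, so shifted families are restricted to \<open>carrier H\<close>.\<close>

definition shift_action :: "('h, 'q) monoid_scheme \<Rightarrow> 'h \<Rightarrow> ('h \<Rightarrow> 'a) \<Rightarrow> ('h \<Rightarrow> 'a)" where
  "shift_action H h x = (\<lambda>a\<in>carrier H. x (inv\<^bsub>H\<^esub> h \<otimes>\<^bsub>H\<^esub> a))"

definition wreath_product ::
  "('a, 'm) monoid_scheme \<Rightarrow> ('h, 'q) monoid_scheme \<Rightarrow> (('h \<Rightarrow> 'a) \<times> 'h) monoid"
  where
  "wreath_product \<Lambda> H =
     semidirect_product (sum_group (carrier H) (\<lambda>_. \<Lambda>)) H (shift_action H)"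

abbreviation discrete_top :: "('a, 'm) monoid_scheme \<Rightarrow> 'a topology" where
  "discrete_top G \<equiv> discrete_topology (carrier G)"

definition commutator_subgroup :: "('a, 'm) monoid_scheme \<Rightarrow> 'a set" where
  "commutator_subgroup G = derived G (carrier G)"

definition abelianization :: "('a, 'm) monoid_scheme \<Rightarrow> 'a set monoid" where
  "abelianization G = G Mod commutator_subgroup G"

definition perfect_group :: "('a, 'm) monoid_scheme \<Rightarrow> bool" where
  "perfect_group G \<longleftrightarrow> carrier G = commutator_subgroup G"

definition wreath_abelianization_map ::
  "('a, 'm) monoid_scheme \<Rightarrow> ('h, 'q) monoid_scheme \<Rightarrow> ('h \<Rightarrow> 'a) \<times> 'h \<Rightarrow> ('h \<Rightarrow> 'a set) \<times> 'h"
  where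
  "wreath_abelianization_map \<Lambda> H =
     (\<lambda>(x, h). (\<lambda>a\<in>carrier H. commutator_subgroup \<Lambda> #>\<^bsub>\<Lambda>\<^esub> x a, h))"

lemma subgroup_closure_of_image:
  assumes G: "group G" and L: "topological_group L V" and f: "f \<in> hom G L"
  shows "subgroup (V closure_of (f ` carrier G)) L"
proof -
  interpret L: group L using L by (simp add: topological_group_def)
  have top: "topspace V = carrier L" using L by (simp add: topological_group_def)
  let ?S = "f ` carrier G"
  have sub: "subgroup ?S L"
    using G f L.group_axioms by (simp add: group_hom.img_is_subgroup group_hom_axioms_def group_hom_def)
  show ?thesis
  proof
    show "V closure_of ?S \<subseteq> carrier L"
      using top closure_of_subset_topspace by metis
    show "\<one>\<^bsub>L\<^esub> \<in> V closure_of ?S"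
      using subsetD[OF closure_of_subset[of ?S V] subgroup.one_closed[OF sub]] subgroup.subset[OF sub] top
      by simp
  next
    fix x assume x: "x \<in> V closure_of ?S"
    have "(\<lambda>x. inv\<^bsub>L\<^esub> x) ` (V closure_of ?S) \<subseteq> V closure_of ((\<lambda>x. inv\<^bsub>L\<^esub> x) ` ?S)"
      using L by (intro continuous_map_image_closure_subset) (simp add: topological_group_def)
    moreover have "V closure_of ((\<lambda>x. inv\<^bsub>L\<^esub> x) ` ?S) \<subseteq> V closure_of ?S"
      using sub by (intro closure_of_mono) (auto simp: subgroup.m_inv_closed)
    ultimately show "inv\<^bsub>L\<^esub> x \<in> V closure_of ?S" using x by blast
  next
    fix x y assume xy: "x \<in> V closure_of ?S" "y \<in> V closure_of ?S"
    have "(\<lambda>(x, y). x \<otimes>\<^bsub>L\<^esub> y) ` (prod_topology V V closure_of (?S \<times> ?S))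
        \<subseteq> V closure_of ((\<lambda>(x, y). x \<otimes>\<^bsub>L\<^esub> y) ` (?S \<times> ?S))"
      using L by (intro continuous_map_image_closure_subset) (simp add: topological_group_def)
    moreover have "V closure_of ((\<lambda>(x, y). x \<otimes>\<^bsub>L\<^esub> y) ` (?S \<times> ?S)) \<subseteq> V closure_of ?S"
      using sub by (intro closure_of_mono) (auto simp: subgroup.m_closed)
    ultimately show "x \<otimes>\<^bsub>L\<^esub> y \<in> V closure_of ?S"
      using xy by (auto simp: closure_of_Times)
  qed
qed

lemma topological_group_subgroup:
  assumes L: "topological_group L V" and C: "subgroup C L"
  shows "topological_group (L\<lparr>carrier := C\<rparr>) (subtopology V C)"
proof -
  interpret L: group L using L by (simp add: topological_group_def)
  have top: "topspace V = carrier L" using L by (simp add: topological_group_def)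
  have CL: "C \<subseteq> carrier L" using C by (rule subgroup.subset)
  have "continuous_map (prod_topology (subtopology V C) (subtopology V C)) (subtopology V C)
          (\<lambda>(x, y). x \<otimes>\<^bsub>L\<^esub> y)"
    using L C
    by (auto simp: topological_group_def continuous_map_in_subtopology continuous_map_from_subtopology
        subgroup.m_closed simp flip: subtopology_Times)
  moreover have "continuous_map (subtopology V C) (subtopology V C) (\<lambda>x. inv\<^bsub>L\<^esub> x)"
    using L C
    by (auto simp: topological_group_def continuous_map_in_subtopology continuous_map_from_subtopology
        subgroup.m_inv_closed)
  then have "continuous_map (subtopology V C) (subtopology V C) (\<lambda>x. inv\<^bsub>L\<lparr>carrier := C\<rparr>\<^esub> x)"
    by (rule continuous_map_eq) (use C L.m_inv_consistent in auto)
  ultimately show ?thesis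
    using C CL top L.subgroup_imp_group by (simp add: topological_group_def Int_absorb1)
qed

lemma compact_group_subgroup:
  assumes "compact_group L V" "subgroup C L" "closedin V C"
  shows "compact_group (L\<lparr>carrier := C\<rparr>) (subtopology V C)"
  using assms
  by (simp add: compact_group_def topological_group_subgroup Hausdorff_space_subtopology
      closedin_compact_space compact_space_subtopology)

lemma profinite_group_subgroup:
  assumes "profinite_group L V" "subgroup C L" "closedin V C"
  shows "profinite_group (L\<lparr>carrier := C\<rparr>) (subtopology V C)"
  using assms
  by (auto simp: profinite_group_def compact_group_subgroup totally_disconnected_space_def
      connectedin_subtopology)

lemma topological_group_transport:
  assumes L: "topological_group L V" and i: "inj_on i (carrier L)"
  obtains L' :: "'b monoid" and V' j where
    "topological_group L' V'" "homeomorphic_maps V V' i j" "i \<in> hom L L'" "j \<in> hom L' L"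
proof -
  interpret L: group L using L by (simp add: topological_group_def)
  have top: "topspace V = carrier L" using L by (simp add: topological_group_def)
  define j where "j = inv_into (carrier L) i"
  have ji [simp]: "j (i x) = x" if "x \<in> carrier L" for x
    using that i by (simp add: j_def)
  define L' where "L' = \<lparr>carrier = i ` carrier L, mult = (\<lambda>a b. i (j a \<otimes>\<^bsub>L\<^esub> j b)), one = i \<one>\<^bsub>L\<^esub>\<rparr>"
  define V' where "V' = pullback_topology (i ` carrier L) j V"
  have top': "topspace V' = i ` carrier L"
    using top by (auto simp: V'_def topspace_pullback_topology)
  have hi: "i \<in> hom L L'" and hj: "j \<in> hom L' L"
    by (auto simp: hom_def L'_def)
  have grp: "group L'"
  proof (rule groupI)
    fix x assume "x \<in> carrier L'"
    then obtain y where "y \<in> carrier L" "x = i y" by (auto simp: L'_def)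
    then show "\<exists>y\<in>carrier L'. y \<otimes>\<^bsub>L'\<^esub> x = \<one>\<^bsub>L'\<^esub>"
      by (intro bexI[of _ "i (inv\<^bsub>L\<^esub> y)"]) (auto simp: L'_def)
  qed (auto simp: L'_def L.m_assoc)
  have cj: "continuous_map V' V j"
    unfolding V'_def by (metis continuous_map_id continuous_map_pullback id_comp)
  have ci: "continuous_map V V' i"
    unfolding V'_def
  proof (rule continuous_map_pullback')
    show "continuous_map V V (j \<circ> i)"
      by (rule continuous_map_eq[OF continuous_map_id]) (simp add: top)
  qed (auto simp: top)
  have hm: "homeomorphic_maps V V' i j"
    using ci cj by (auto simp: homeomorphic_maps_def top top')
  have "continuous_map (prod_topology V' V') V' (i \<circ> ((\<lambda>(x, y). x \<otimes>\<^bsub>L\<^esub> y) \<circ> (\<lambda>(x, y). (j x, j y))))"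
    using L cj ci
    by (intro continuous_map_compose[OF continuous_map_compose])
       (auto simp: topological_group_def continuous_map_prod_top)
  moreover have "i \<circ> ((\<lambda>(x, y). x \<otimes>\<^bsub>L\<^esub> y) \<circ> (\<lambda>(x, y). (j x, j y))) = (\<lambda>(x, y). x \<otimes>\<^bsub>L'\<^esub> y)"
    by (auto simp: L'_def)
  ultimately have "continuous_map (prod_topology V' V') V' (\<lambda>(x, y). x \<otimes>\<^bsub>L'\<^esub> y)" by simp
  moreover have "continuous_map V' V' (i \<circ> ((\<lambda>x. inv\<^bsub>L\<^esub> x) \<circ> j))"
    using L cj ci by (intro continuous_map_compose[OF continuous_map_compose]) (auto simp: topological_group_def)
  then have "continuous_map V' V' (\<lambda>x. inv\<^bsub>L'\<^esub> x)"
  proof (rule continuous_map_eq)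
    fix x assume "x \<in> topspace V'"
    then obtain y where y: "y \<in> carrier L" "x = i y" using top' by auto
    have "inv\<^bsub>L'\<^esub> (i y) = i (inv\<^bsub>L\<^esub> y)"
      using y hi grp L.group_axioms by (metis group_hom.hom_inv group_hom_axioms_def group_hom_def)
    then show "(i \<circ> ((\<lambda>x. inv\<^bsub>L\<^esub> x) \<circ> j)) x = inv\<^bsub>L'\<^esub> x" using y by simp
  qed
  ultimately have "topological_group L' V'"
    using grp top' by (simp add: topological_group_def L'_def)
  then show thesis using that hm hi hj by blast
qed

lemma compact_group_homeomorphic:
  assumes "compact_group L V" "topological_group L' V'" "homeomorphic_maps V V' i j"
  shows "compact_group L' V'"
proof -
  have "V homeomorphic_space V'"
    using assms(3) homeomorphic_space_def by blast
  then show ?thesis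
    using assms(1,2) homeomorphic_compact_space[of V V'] homeomorphic_Hausdorff_space[of V V']
    by (simp add: compact_group_def)
qed

lemma profinite_group_homeomorphic:
  assumes "profinite_group L V" "topological_group L' V'" "homeomorphic_maps V V' i j"
  shows "profinite_group L' V'"
proof -
  have "\<exists>x. S \<subseteq> {x}" if S: "connectedin V' S" for S
  proof -
    have "connectedin V (j ` S)"
      using assms(3) S by (auto simp: homeomorphic_maps_def intro: connectedin_continuous_map_image)
    then obtain x where "j ` S \<subseteq> {x}"
      using assms(1) by (auto simp: profinite_group_def totally_disconnected_space_def)
    moreover have "S = i ` j ` S"
      using assms(3) S connectedin_subset_topspace[OF S] by (force simp: homeomorphic_maps_def image_iff)
    ultimately have "S \<subseteq> {i x}" by blast
    then show ?thesis by blast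
  qed
  then show ?thesis
    using assms compact_group_homeomorphic[of L V L' V' i j]
    by (auto simp: profinite_group_def totally_disconnected_space_def)
qed

lemma inj_on_traces:
  assumes "Hausdorff_space V"
  shows "inj_on (\<lambda>x. {f -` U \<inter> A | U. openin V U \<and> x \<in> U}) (V closure_of (f ` A))"
proof (rule inj_onI, rule ccontr)
  fix x y
  assume x: "x \<in> V closure_of (f ` A)" and y: "y \<in> V closure_of (f ` A)" and "x \<noteq> y"
    and eq: "{f -` U \<inter> A | U. openin V U \<and> x \<in> U} = {f -` U \<inter> A | U. openin V U \<and> y \<in> U}"
  obtain U W where UW: "openin V U" "openin V W" "x \<in> U" "y \<in> W" "disjnt U W"
    using assms x y \<open>x \<noteq> y\<close> unfolding Hausdorff_space_def by (meson in_closure_of)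
  have "f -` U \<inter> A \<in> {f -` U \<inter> A | U. openin V U \<and> x \<in> U}" using UW by blast
  then obtain W' where W': "openin V W'" "y \<in> W'" "f -` U \<inter> A = f -` W' \<inter> A"
    unfolding eq by blast
  then have "openin V (W \<inter> W')" "y \<in> W \<inter> W'" using UW by auto
  then obtain a where "a \<in> A" "f a \<in> W \<inter> W'"
    using y by (auto simp: in_closure_of)
  then show False using W'(3) UW(5) by (auto simp: disjnt_iff)
qed

lemma test_group_in_type:
  fixes f :: "'g \<Rightarrow> 'l"
  assumes G: "topological_group G T" and L: "compact_group L V" and f: "continuous_hom G T L V f"
  obtains L' :: "'g set set monoid" and V' i j where
    "compact_group L' V'" "profinite_group L V \<Longrightarrow> profinite_group L' V'"
    "continuous_hom G T L' V' (i \<circ> f)" "continuous_hom L' V' L V j"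
    "\<And>g. g \<in> carrier G \<Longrightarrow> j (i (f g)) = f g"
proof -
  let ?S = "f ` carrier G"
  let ?C = "V closure_of ?S"
  let ?L = "L\<lparr>carrier := ?C\<rparr>" and ?V = "subtopology V ?C"
  have fh: "f \<in> hom G L" and fc: "continuous_map T V f" using f by (auto simp: continuous_hom_def)
  have Lt: "topological_group L V" "Hausdorff_space V" using L by (auto simp: compact_group_def)
  have top: "topspace V = carrier L" "topspace T = carrier G"
    using Lt G by (auto simp: topological_group_def)
  have C: "subgroup ?C L"
    using G Lt fh by (intro subgroup_closure_of_image) (auto simp: topological_group_def)
  have SC: "?S \<subseteq> ?C" using fh top by (intro closure_of_subset) (auto simp: hom_def)
  have Lc: "compact_group ?L ?V" by (rule compact_group_subgroup[OF L C closedin_closure_of])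
  have tg: "topological_group ?L ?V" using Lc by (simp add: compact_group_def)
  define i where "i = (\<lambda>x. {f -` U \<inter> carrier G | U. openin V U \<and> x \<in> U})"
  have "inj_on i (carrier ?L)"
    using inj_on_traces[OF Lt(2), of f "carrier G"] by (simp add: i_def)
  from topological_group_transport[OF tg this]
  obtain L' :: "'g set set monoid" and V' j
    where tr: "topological_group L' V'" "homeomorphic_maps ?V V' i j" "i \<in> hom ?L L'" "j \<in> hom L' ?L"
    by blast
  show thesis
  proof (rule that)
    show "compact_group L' V'" by (rule compact_group_homeomorphic[OF Lc tr(1,2)])
    show "profinite_group L' V'" if "profinite_group L V"
      by (rule profinite_group_homeomorphic[OF profinite_group_subgroup[OF that C closedin_closure_of] tr(1,2)])
    have "f \<in> hom G ?L" using fh SC by (auto simp: hom_def)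
    moreover have "continuous_map T ?V f"
      using fc SC top by (auto intro!: continuous_map_into_subtopology)
    ultimately show "continuous_hom G T L' V' (i \<circ> f)"
      using tr by (auto simp: continuous_hom_def homeomorphic_maps_def hom_compose
          intro: continuous_map_compose)
    have "j \<in> hom L' L" using tr(4) subgroup.subset[OF C] by (auto simp: hom_def)
    then show "continuous_hom L' V' L V j"
      using tr(2) continuous_map_into_fulltopology
      unfolding continuous_hom_def homeomorphic_maps_def by blast
    show "j (i (f g)) = f g" if "g \<in> carrier G" for g
    proof -
      have "f g \<in> topspace ?V" using SC that subgroup.subset[OF C] top by auto
      then show ?thesis using tr(2) unfolding homeomorphic_maps_def by blast
    qed
  qed
qed

lemma continuous_hom_compose:
  "continuous_hom G T K U f \<Longrightarrow> continuous_hom K U L V g \<Longrightarrow> continuous_hom G T L V (g \<circ> f)"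
  by (auto simp: continuous_hom_def hom_compose intro: continuous_map_compose)

lemma bohr_compactification_universal:
  fixes G :: "('g, 'm) monoid_scheme"
  assumes K: "bohr_compactification G T K U \<beta>"
    and L: "compact_group L V" and f: "continuous_hom G T L V f"
  shows "\<exists>\<phi>. continuous_hom K U L V \<phi> \<and> (\<forall>g\<in>carrier G. \<phi> (\<beta> g) = f g)"
proof (rule test_group_in_type[OF _ _ f])
  show "topological_group G T" using K by (simp add: bohr_compactification_def)
  show "compact_group L V" by (fact L)
  fix L' :: "'g set set monoid" and V' i j
  assume L': "compact_group L' V'" and i: "continuous_hom G T L' V' (i \<circ> f)"
    and j: "continuous_hom L' V' L V j" and ji: "\<And>g. g \<in> carrier G \<Longrightarrow> j (i (f g)) = f g"
  have "compact_group L' V' \<and> continuous_hom G T L' V' (i \<circ> f)" using L' L i by simp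
  moreover have "\<forall>(L :: 'g set set monoid) V f. compact_group L V \<and> continuous_hom G T L V f \<longrightarrow>
      (\<exists>\<phi>. continuous_hom K U L V \<phi> \<and> (\<forall>g\<in>carrier G. \<phi> (\<beta> g) = f g))"
    using K by (simp add: bohr_compactification_def)
  ultimately obtain \<phi> where \<phi>: "continuous_hom K U L' V' \<phi>" "\<forall>g\<in>carrier G. \<phi> (\<beta> g) = (i \<circ> f) g"
    by meson
  have "continuous_hom K U L V (j \<circ> \<phi>)"
    using continuous_hom_compose[OF \<phi>(1) j] by simp
  moreover have "\<forall>g\<in>carrier G. (j \<circ> \<phi>) (\<beta> g) = f g" using \<phi>(2) ji by simp
  ultimately show ?thesis by blast
qed

lemma profinite_completion_universal:
  fixes G :: "('g, 'm) monoid_scheme"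
  assumes K: "profinite_completion G T K U \<alpha>"
    and L: "profinite_group L V" and f: "continuous_hom G T L V f"
  shows "\<exists>\<phi>. continuous_hom K U L V \<phi> \<and> (\<forall>g\<in>carrier G. \<phi> (\<alpha> g) = f g)"
proof (rule test_group_in_type[OF _ _ f])
  show "topological_group G T" using K by (simp add: profinite_completion_def)
  show "compact_group L V" using L by (simp add: profinite_group_def)
  fix L' :: "'g set set monoid" and V' i j
  assume L': "profinite_group L V \<Longrightarrow> profinite_group L' V'" and i: "continuous_hom G T L' V' (i \<circ> f)"
    and j: "continuous_hom L' V' L V j" and ji: "\<And>g. g \<in> carrier G \<Longrightarrow> j (i (f g)) = f g"
  have "profinite_group L' V' \<and> continuous_hom G T L' V' (i \<circ> f)" using L' L i by simp
  moreover have "\<forall>(L :: 'g set set monoid) V f. profinite_group L V \<and> continuous_hom G T L V f \<longrightarrow>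
      (\<exists>\<phi>. continuous_hom K U L V \<phi> \<and> (\<forall>g\<in>carrier G. \<phi> (\<alpha> g) = f g))"
    using K by (simp add: profinite_completion_def)
  ultimately obtain \<phi> where \<phi>: "continuous_hom K U L' V' \<phi>" "\<forall>g\<in>carrier G. \<phi> (\<alpha> g) = (i \<circ> f) g"
    by meson
  have "continuous_hom K U L V (j \<circ> \<phi>)"
    using continuous_hom_compose[OF \<phi>(1) j] by simp
  moreover have "\<forall>g\<in>carrier G. (j \<circ> \<phi>) (\<alpha> g) = f g" using \<phi>(2) ji by simp
  ultimately show ?thesis by blast
qed

lemma topological_group_product:
  assumes L: "\<And>i. i \<in> I \<Longrightarrow> topological_group (L i) (V i)"
  shows "topological_group (product_group I L) (product_topology V I)"
proof -
  have grp: "group (L i)" and top: "topspace (V i) = carrier (L i)" if "i \<in> I" for i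
    using L[OF that] by (auto simp: topological_group_def)
  have *: "continuous_map (product_topology V I) (V i) (\<lambda>x. x i)" if "i \<in> I" for i
    using that by (rule continuous_map_product_projection)
  have "continuous_map (prod_topology (product_topology V I) (product_topology V I)) (V i)
          (\<lambda>z. fst z i \<otimes>\<^bsub>L i\<^esub> snd z i)" if i: "i \<in> I" for i
  proof -
    have "continuous_map (prod_topology (product_topology V I) (product_topology V I)) (prod_topology (V i) (V i))
            (\<lambda>z. (fst z i, snd z i))"
      by (intro continuous_map_pairedI continuous_map_compose[OF continuous_map_fst *[OF i], unfolded o_def]
          continuous_map_compose[OF continuous_map_snd *[OF i], unfolded o_def])
    moreover have "continuous_map (prod_topology (V i) (V i)) (V i) (\<lambda>(x, y). x \<otimes>\<^bsub>L i\<^esub> y)"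
      using L[OF i] by (simp add: topological_group_def)
    ultimately have "continuous_map (prod_topology (product_topology V I) (product_topology V I)) (V i)
        ((\<lambda>(x, y). x \<otimes>\<^bsub>L i\<^esub> y) \<circ> (\<lambda>z. (fst z i, snd z i)))"
      by (rule continuous_map_compose)
    then show ?thesis by (simp add: o_def)
  qed
  then have "continuous_map (prod_topology (product_topology V I) (product_topology V I)) (product_topology V I)
          (\<lambda>(x, y). x \<otimes>\<^bsub>product_group I L\<^esub> y)"
    by (auto simp: continuous_map_componentwise case_prod_unfold cong: restrict_cong)
  moreover have "continuous_map (product_topology V I) (product_topology V I) (\<lambda>x. \<lambda>i\<in>I. inv\<^bsub>L i\<^esub> (x i))"
  proof -
    have "continuous_map (product_topology V I) (V i) (\<lambda>x. inv\<^bsub>L i\<^esub> (x i))" if i: "i \<in> I" for i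
      using continuous_map_compose[OF *[OF i], of "V i" "\<lambda>x. inv\<^bsub>L i\<^esub> x"] L[OF i]
      by (simp add: topological_group_def o_def)
    then show ?thesis by (auto simp: continuous_map_componentwise)
  qed
  then have "continuous_map (product_topology V I) (product_topology V I) (\<lambda>x. inv\<^bsub>product_group I L\<^esub> x)"
    by (rule continuous_map_eq) (use grp top in \<open>auto simp: inv_product_group PiE_iff\<close>)
  ultimately show ?thesis
    using grp top by (auto simp: topological_group_def cong: PiE_cong)
qed

lemma compact_group_product:
  assumes "\<And>i. i \<in> I \<Longrightarrow> compact_group (L i) (V i)"
  shows "compact_group (product_group I L) (product_topology V I)"
  using assms
  by (auto simp: compact_group_def topological_group_product compact_space_product_topology
      Hausdorff_space_product_topology)

lemma profinite_group_product:
  assumes L: "\<And>i. i \<in> I \<Longrightarrow> profinite_group (L i) (V i)"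
  shows "profinite_group (product_group I L) (product_topology V I)"
proof -
  have "\<exists>x. S \<subseteq> {x}" if S: "connectedin (product_topology V I) S" for S
  proof -
    have "\<exists>c. (\<lambda>x. x i) ` S \<subseteq> {c}" if i: "i \<in> I" for i
      using L[OF i] connectedin_continuous_map_image[OF continuous_map_product_projection[OF i] S]
      by (auto simp: profinite_group_def totally_disconnected_space_def)
    then obtain c where c: "\<And>i x. i \<in> I \<Longrightarrow> x \<in> S \<Longrightarrow> x i = c i"
      by (metis image_subset_iff singletonD)
    have "S \<subseteq> extensional I"
      using connectedin_subset_topspace[OF S] by (auto simp: PiE_iff)
    then have "S \<subseteq> {restrict c I}"
      using c by (auto simp: extensional_def fun_eq_iff subset_iff)
    then show ?thesis by blast
  qed
  then show ?thesis
    using L compact_group_product[of I L V]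
    by (metis profinite_group_def totally_disconnected_space_def)
qed

lemma dense_image_in_product:
  fixes G :: "('g, 'm) monoid_scheme" and I :: "('l monoid \<times> 'l topology \<times> ('g \<Rightarrow> 'l)) set"
  assumes G: "topological_group G T"
    and I: "\<And>L V f. (L, V, f) \<in> I \<Longrightarrow> compact_group L V \<and> continuous_hom G T L V f"
  obtains K :: "(('l monoid \<times> 'l topology \<times> ('g \<Rightarrow> 'l)) \<Rightarrow> 'l) monoid" and U \<beta> where
    "compact_group K U" "(\<And>L V f. (L, V, f) \<in> I \<Longrightarrow> profinite_group L V) \<Longrightarrow> profinite_group K U"
    "continuous_hom G T K U \<beta>" "U closure_of (\<beta> ` carrier G) = carrier K"
    "\<And>L V f. (L, V, f) \<in> I \<Longrightarrow> \<exists>\<phi>. continuous_hom K U L V \<phi> \<and> (\<forall>g\<in>carrier G. \<phi> (\<beta> g) = f g)"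
proof -
  let ?L = "\<lambda>i :: 'l monoid \<times> 'l topology \<times> ('g \<Rightarrow> 'l). fst i"
  let ?V = "\<lambda>i :: 'l monoid \<times> 'l topology \<times> ('g \<Rightarrow> 'l). fst (snd i)"
  let ?f = "\<lambda>i :: 'l monoid \<times> 'l topology \<times> ('g \<Rightarrow> 'l). snd (snd i)"
  define P where "P = product_group I ?L"
  define W where "W = product_topology ?V I"
  define \<beta> where "\<beta> = (\<lambda>g. \<lambda>i\<in>I. ?f i g)"
  define C where "C = W closure_of (\<beta> ` carrier G)"
  have I': "compact_group (?L i) (?V i)" "continuous_hom G T (?L i) (?V i) (?f i)" if "i \<in> I" for i
    using I[of "?L i" "?V i" "?f i"] that by auto
  have f_hom: "?f i \<in> hom G (?L i)" if "i \<in> I" for i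
    using I'(2)[OF that] by (simp add: continuous_hom_def)
  have P: "compact_group P W"
    unfolding P_def W_def by (rule compact_group_product) (rule I'(1))
  then have topW: "topspace W = carrier P" by (simp add: compact_group_def topological_group_def)
  have topG: "topspace T = carrier G" using G by (simp add: topological_group_def)
  have hom: "\<beta> \<in> hom G P"
  proof (rule homI)
    fix x assume "x \<in> carrier G"
    then show "\<beta> x \<in> carrier P"
      using hom_in_carrier[OF f_hom] unfolding \<beta>_def P_def by simp
  next
    fix x y assume "x \<in> carrier G" "y \<in> carrier G"
    then show "\<beta> (x \<otimes>\<^bsub>G\<^esub> y) = \<beta> x \<otimes>\<^bsub>P\<^esub> \<beta> y"
      using hom_mult[OF f_hom] unfolding \<beta>_def P_def by (simp cong: restrict_cong)
  qed
  have cont: "continuous_map T W \<beta>"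
    using I' by (auto simp: W_def \<beta>_def continuous_map_componentwise continuous_hom_def)
  have C: "subgroup C P"
    unfolding C_def using G P hom
    by (intro subgroup_closure_of_image) (auto simp: topological_group_def compact_group_def)
  have clC: "closedin W C" by (simp add: C_def)
  have SC: "\<beta> ` carrier G \<subseteq> C"
    unfolding C_def using hom topW by (intro closure_of_subset) (auto simp: hom_def)
  show thesis
  proof (rule that)
    show "compact_group (P\<lparr>carrier := C\<rparr>) (subtopology W C)"
      by (rule compact_group_subgroup[OF P C clC])
    show "profinite_group (P\<lparr>carrier := C\<rparr>) (subtopology W C)"
      if "\<And>L V f. (L, V, f) \<in> I \<Longrightarrow> profinite_group L V"
    proof (rule profinite_group_subgroup[OF _ C clC])
      show "profinite_group P W"
        unfolding P_def W_def
      proof (rule profinite_group_product)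
        fix i assume "i \<in> I"
        then show "profinite_group (?L i) (?V i)"
          using that[of "?L i" "?V i" "?f i"] by simp
      qed
    qed
    show "continuous_hom G T (P\<lparr>carrier := C\<rparr>) (subtopology W C) \<beta>"
      using hom cont SC topG
      by (auto simp: continuous_hom_def hom_def continuous_map_in_subtopology)
    show "subtopology W C closure_of (\<beta> ` carrier G) = carrier (P\<lparr>carrier := C\<rparr>)"
      using SC by (simp add: closure_of_subtopology Int_absorb1 flip: C_def)
    fix L V f assume i: "(L, V, f) \<in> I"
    have "(\<lambda>x. x (L, V, f)) \<in> hom (P\<lparr>carrier := C\<rparr>) L"
      using subgroup.subset[OF C] i by (force simp: hom_def P_def PiE_iff)
    moreover have "continuous_map (subtopology W C) V (\<lambda>x. x (L, V, f))"
      using continuous_map_product_projection[OF i, of ?V]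
      by (simp add: W_def continuous_map_from_subtopology)
    moreover have "\<beta> g (L, V, f) = f g" for g using i by (simp add: \<beta>_def)
    ultimately show "\<exists>\<phi>. continuous_hom (P\<lparr>carrier := C\<rparr>) (subtopology W C) L V \<phi> \<and>
        (\<forall>g\<in>carrier G. \<phi> (\<beta> g) = f g)"
      unfolding continuous_hom_def by blast
  qed
qed

lemma bohr_compactification_exists:
  fixes G :: "('g, 'm) monoid_scheme"
  assumes G: "topological_group G T"
  shows "\<exists>(K :: ('g set set monoid \<times> 'g set set topology \<times> ('g \<Rightarrow> 'g set set) \<Rightarrow> 'g set set) monoid)
    U \<beta>. bohr_compactification G T K U \<beta>"
proof (rule dense_image_in_product[OF G, of "{(L, V, f). compact_group L V \<and> continuous_hom G T L V f}"])
  fix K :: "('g set set monoid \<times> 'g set set topology \<times> ('g \<Rightarrow> 'g set set) \<Rightarrow> 'g set set) monoid" and U \<beta>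
  assume "compact_group K U"
    and "continuous_hom G T K U \<beta>" "U closure_of (\<beta> ` carrier G) = carrier K"
    and "\<And>(L :: 'g set set monoid) V f. (L, V, f) \<in> {(L, V, f). compact_group L V \<and> continuous_hom G T L V f} \<Longrightarrow>
      \<exists>\<phi>. continuous_hom K U L V \<phi> \<and> (\<forall>g\<in>carrier G. \<phi> (\<beta> g) = f g)"
  then have "bohr_compactification G T K U \<beta>"
    using G by (auto simp: bohr_compactification_def)
  then show ?thesis by blast
qed simp

lemma profinite_completion_exists:
  fixes G :: "('g, 'm) monoid_scheme"
  assumes G: "topological_group G T"
  shows "\<exists>(K :: ('g set set monoid \<times> 'g set set topology \<times> ('g \<Rightarrow> 'g set set) \<Rightarrow> 'g set set) monoid)
    U \<alpha>. profinite_completion G T K U \<alpha>"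
proof (rule dense_image_in_product[OF G, of "{(L, V, f). profinite_group L V \<and> continuous_hom G T L V f}"])
  fix K :: "('g set set monoid \<times> 'g set set topology \<times> ('g \<Rightarrow> 'g set set) \<Rightarrow> 'g set set) monoid" and U \<alpha>
  assume "(\<And>(L :: 'g set set monoid) V f. (L, V, f) \<in> {(L, V, f). profinite_group L V \<and> continuous_hom G T L V f} \<Longrightarrow> profinite_group L V) \<Longrightarrow> profinite_group K U"
    and "continuous_hom G T K U \<alpha>" "U closure_of (\<alpha> ` carrier G) = carrier K"
    and "\<And>(L :: 'g set set monoid) V f. (L, V, f) \<in> {(L, V, f). profinite_group L V \<and> continuous_hom G T L V f} \<Longrightarrow>
      \<exists>\<phi>. continuous_hom K U L V \<phi> \<and> (\<forall>g\<in>carrier G. \<phi> (\<alpha> g) = f g)"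
  then have "profinite_completion G T K U \<alpha>"
    using G by (auto simp: profinite_completion_def)
  then show ?thesis by blast
qed (simp add: profinite_group_def)

lemma topological_group_discrete:
  assumes "group G"
  shows "topological_group G (discrete_topology (carrier G))"
proof -
  interpret group G by fact
  have "continuous_map (discrete_topology (carrier G \<times> carrier G)) (discrete_topology (carrier G))
      (\<lambda>(x, y). x \<otimes>\<^bsub>G\<^esub> y)"
    by auto
  then show ?thesis
    using assms by (simp add: topological_group_def prod_topology_discrete_topology)
qed

lemma finite_group_own_completion:
  assumes "group H" "finite (carrier H)"
  shows "bohr_compactification H (discrete_topology (carrier H)) H (discrete_topology (carrier H)) id"
    and "profinite_completion H (discrete_topology (carrier H)) H (discrete_topology (carrier H)) id"
proof -
  have "totally_disconnected_space (discrete_topology (carrier H))"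
    unfolding totally_disconnected_space_def by (metis connectedin_discrete_topology)
  moreover have "compact_group H (discrete_topology (carrier H))"
    using assms by (simp add: compact_group_def topological_group_discrete compact_space_discrete_topology)
  moreover have "continuous_hom H T H T id" for T by (auto simp: continuous_hom_def hom_def)
  ultimately show "bohr_compactification H (discrete_topology (carrier H)) H (discrete_topology (carrier H)) id"
    "profinite_completion H (discrete_topology (carrier H)) H (discrete_topology (carrier H)) id"
    unfolding bohr_compactification_def profinite_completion_def profinite_group_def compact_group_def
    using closure_of_topspace[of "discrete_topology (carrier H)"] by auto
qed

lemma induced_map_unique:
  assumes "Hausdorff_space U\<^sub>2" "U\<^sub>1 closure_of (\<beta>\<^sub>1 ` carrier G) = carrier K\<^sub>1"
    and "induced_map G f K\<^sub>1 U\<^sub>1 \<beta>\<^sub>1 K\<^sub>2 U\<^sub>2 \<beta>\<^sub>2 \<phi>" "induced_map G f K\<^sub>1 U\<^sub>1 \<beta>\<^sub>1 K\<^sub>2 U\<^sub>2 \<beta>\<^sub>2 \<psi>"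
    and "x \<in> carrier K\<^sub>1"
  shows "\<phi> x = \<psi> x"
proof (rule forall_in_closure_of_eq[of x U\<^sub>1 "\<beta>\<^sub>1 ` carrier G" U\<^sub>2])
  show "x \<in> U\<^sub>1 closure_of (\<beta>\<^sub>1 ` carrier G)" using assms(2,5) by simp
  show "\<phi> y = \<psi> y" if "y \<in> \<beta>\<^sub>1 ` carrier G" for y
    using that assms(3,4) by (auto simp: induced_map_def)
qed (use assms in \<open>auto simp: induced_map_def continuous_hom_def\<close>)


lemma group_wreath_product:
  assumes "group \<Lambda>" "group H"
  shows "group (wreath_product \<Lambda> H)"
proof -
  interpret H: group H by fact
  interpret L: group \<Lambda> by fact
  let ?N = "sum_group (carrier H) (\<lambda>_. \<Lambda>)"
  interpret N: group ?N by (simp add: assms)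
  have carr: "carrier ?N = {x \<in> carrier H \<rightarrow>\<^sub>E carrier \<Lambda>. finite {i \<in> carrier H. x i \<noteq> \<one>\<^bsub>\<Lambda>\<^esub>}}"
    by (simp add: carrier_sum_group assms)
  have closed: "shift_action H h x \<in> carrier ?N" if h: "h \<in> carrier H" and x: "x \<in> carrier ?N" for h x
  proof -
    have "{i \<in> carrier H. shift_action H h x i \<noteq> \<one>\<^bsub>\<Lambda>\<^esub>} \<subseteq> (\<lambda>a. h \<otimes>\<^bsub>H\<^esub> a) ` {i \<in> carrier H. x i \<noteq> \<one>\<^bsub>\<Lambda>\<^esub>}"
    proof
      fix i assume "i \<in> {i \<in> carrier H. shift_action H h x i \<noteq> \<one>\<^bsub>\<Lambda>\<^esub>}"
      then show "i \<in> (\<lambda>a. h \<otimes>\<^bsub>H\<^esub> a) ` {i \<in> carrier H. x i \<noteq> \<one>\<^bsub>\<Lambda>\<^esub>}"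
        using h by (intro image_eqI[of _ _ "inv\<^bsub>H\<^esub> h \<otimes>\<^bsub>H\<^esub> i"])
          (auto simp: shift_action_def simp flip: H.m_assoc)
    qed
    moreover have "finite {i \<in> carrier H. x i \<noteq> \<one>\<^bsub>\<Lambda>\<^esub>}"
      using x by (simp add: carr)
    ultimately have "finite {i \<in> carrier H. shift_action H h x i \<noteq> \<one>\<^bsub>\<Lambda>\<^esub>}"
      by (rule finite_subset[OF _ finite_imageI])
    moreover have "shift_action H h x \<in> carrier H \<rightarrow>\<^sub>E carrier \<Lambda>"
      using x h by (auto simp: carr shift_action_def PiE_iff)
    ultimately show ?thesis by (simp add: carr)
  qed
  have shift_mult: "shift_action H h (x \<otimes>\<^bsub>?N\<^esub> y) = shift_action H h x \<otimes>\<^bsub>?N\<^esub> shift_action H h y"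
    if "h \<in> carrier H" for h x y
    using that by (auto simp: shift_action_def fun_eq_iff)
  have shift_shift: "shift_action H h (shift_action H k x) = shift_action H (h \<otimes>\<^bsub>H\<^esub> k) x"
    if "h \<in> carrier H" "k \<in> carrier H" for h k x
    using that by (auto simp: shift_action_def fun_eq_iff H.inv_mult_group H.m_assoc)
  have shift_one: "shift_action H \<one>\<^bsub>H\<^esub> x = x" if "x \<in> carrier ?N" for x
    using that by (auto simp: shift_action_def carr fun_eq_iff PiE_iff extensional_def)
  have shift_of_one: "shift_action H h \<one>\<^bsub>?N\<^esub> = \<one>\<^bsub>?N\<^esub>" if "h \<in> carrier H" for h
    using that by (auto simp: shift_action_def fun_eq_iff)
  show ?thesis
    unfolding wreath_product_def semidirect_product_def
  proof (rule groupI, goal_cases)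
    case (1 p q)
    then show ?case using closed by (auto simp del: mult_sum_group)
  next
    case 2
    then show ?case by (auto simp del: one_sum_group)
  next
    case (3 p q r)
    then show ?case
      by (auto simp: shift_mult shift_shift closed N.m_assoc H.m_assoc simp del: mult_sum_group)
  next
    case (4 p)
    then show ?case by (auto simp: shift_one simp del: mult_sum_group one_sum_group)
  next
    case (5 p)
    obtain x h where p: "p = (x, h)" "x \<in> carrier ?N" "h \<in> carrier H" using 5 by auto
    have "shift_action H (inv\<^bsub>H\<^esub> h) (inv\<^bsub>?N\<^esub> x) \<otimes>\<^bsub>?N\<^esub> shift_action H (inv\<^bsub>H\<^esub> h) x = \<one>\<^bsub>?N\<^esub>"
      using p shift_of_one N.l_inv shift_mult by (metis H.inv_closed)
    then show ?case
      using p closed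
      by (intro bexI[of _ "(shift_action H (inv\<^bsub>H\<^esub> h) (inv\<^bsub>?N\<^esub> x), inv\<^bsub>H\<^esub> h)"])
         (auto simp del: mult_sum_group one_sum_group inv_sum_group)
  qed
qed

end

theory Submission
  imports Defs
begin

text \<open>
  Two mechanisms are behind the result, one for each part. Neither distinguishes compact from
  profinite groups, so the Bohr and the profinite statements come from the same lemmas, applied to
  the two universal properties. In both parts the universal property of \<open>Bohr(\<Lambda> \<wr> H)\<close> gives a
  continuous homomorphism \<open>\<phi>\<close> to the other group. It is an isomorphism as soon as some continuous
  map in the other direction inverts it on the dense images of \<open>\<Lambda> \<wr> H\<close>
  (\<open>topological_iso_of_inverse_on_dense\<close>).

  For infinite \<open>H\<close>, let \<open>f\<close> be a homomorphism from \<open>\<Lambda> \<wr> H\<close> to a compact group \<open>K\<close>. By pigeonhole,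
  some \<open>h \<noteq> 1\<close> in \<open>H\<close> have images arbitrarily close to the identity of \<open>K\<close>
  (\<open>infinite_group_recurrence\<close>). Conjugation by such an \<open>h\<close> moves a copy of \<open>m \<in> \<Lambda>\<close> from the
  coordinate \<open>a\<close> to the coordinate \<open>ha \<noteq> a\<close>, where it commutes with every \<open>l\<close> placed at \<open>a\<close>; yet it
  hardly changes the image of \<open>m\<close> in \<open>K\<close>. In the limit the images of \<open>l\<close> and \<open>m\<close>, both placed at
  \<open>a\<close>, commute (\<open>coordinate_image_commutes\<close>). So \<open>f\<close> kills all finitely supported families in
  \<open>[\<Lambda>, \<Lambda>]\<close> (\<open>commutator_families_die\<close>) and factors through \<open>\<Lambda>\<^sup>A\<^sup>b \<wr> H\<close>, or through \<open>H\<close> when \<open>\<Lambda>\<close> is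
  perfect; \<open>completion_iso_of_quotient\<close> then yields the isomorphism.

  For finite \<open>H\<close>, the group \<open>Bohr(\<Lambda>) \<wr> H\<close> is itself compact, and the image of \<open>\<Lambda> \<wr> H\<close> in it is dense.
  The inverse of \<open>\<phi>\<close> is the product, over the coordinates \<open>a\<close>, of the continuous extensions to
  \<open>Bohr(\<Lambda>)\<close> of the maps placing an element of \<open>\<Lambda>\<close> at \<open>a\<close>, times the map on \<open>H\<close>
  (\<open>wreath_completion_iso\<close>).
\<close>

section \<open>Topological groups\<close>

text \<open>
  Both composites are continuous and agree with the identity on a dense set, hence everywhere. The
  map \<open>\<psi>\<close> is then multiplicative because it inverts \<open>\<phi>\<close>, so it may be built as a mere product of continuous maps.
\<close>

lemma topological_iso_of_inverse_on_dense:
  assumes K: "topspace U = carrier K" "Hausdorff_space U" "U closure_of (\<kappa> ` A) = carrier K"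
    and L: "topspace W = carrier L" "Hausdorff_space W" "W closure_of (\<eta> ` A) = carrier L"
    and \<phi>: "continuous_hom K U L W \<phi>" "\<And>a. a \<in> A \<Longrightarrow> \<phi> (\<kappa> a) = \<eta> a"
    and \<psi>: "continuous_map W U \<psi>" "\<And>a. a \<in> A \<Longrightarrow> \<psi> (\<eta> a) = \<kappa> a"
  shows "topological_iso K U L W \<phi>"
proof -
  have c: "continuous_map U W \<phi>" and h: "\<phi> \<in> hom K L"
    using \<phi>(1) by (auto simp: continuous_hom_def)
  have cc: "continuous_map U U (\<psi> \<circ> \<phi>)" "continuous_map W W (\<phi> \<circ> \<psi>)"
    using c \<psi>(1) by (auto simp del: o_apply intro: continuous_map_compose)
  have "(\<psi> \<circ> \<phi>) x = id x" if "x \<in> carrier K" for x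
    by (rule forall_in_closure_of_eq[of x U "\<kappa> ` A" U])
      (use that K \<phi> \<psi> cc[unfolded o_def] in auto)
  moreover have "(\<phi> \<circ> \<psi>) y = id y" if "y \<in> carrier L" for y
    by (rule forall_in_closure_of_eq[of y W "\<eta> ` A" W])
      (use that L \<phi> \<psi> cc[unfolded o_def] in auto)
  ultimately have "homeomorphic_map U W \<phi>"
    using c \<psi>(1) K(1) L(1) by (auto simp: homeomorphic_map_maps homeomorphic_maps_def)
  then show ?thesis
    using h K(1) L(1)
    by (auto simp: topological_iso_def iso_def bij_betw_def homeomorphic_eq_everything_map)
qed

lemma continuous_map_group_mult:
  assumes "topological_group K U" "continuous_map T U f" "continuous_map T U g"
  shows "continuous_map T U (\<lambda>x. f x \<otimes>\<^bsub>K\<^esub> g x)"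
proof -
  have "continuous_map T U ((\<lambda>(x, y). x \<otimes>\<^bsub>K\<^esub> y) \<circ> (\<lambda>x. (f x, g x)))"
    using assms by (intro continuous_map_compose[of T "prod_topology U U"])
      (auto simp: topological_group_def continuous_map_pairedI)
  then show ?thesis by (simp add: o_def)
qed

lemma continuous_map_group_inv:
  assumes "topological_group K U" "continuous_map T U f"
  shows "continuous_map T U (\<lambda>x. inv\<^bsub>K\<^esub> (f x))"
  using continuous_map_compose[OF assms(2), of U "\<lambda>x. inv\<^bsub>K\<^esub> x"] assms(1)
  by (simp add: topological_group_def o_def)

text \<open>An open set pulls back to the disjoint union of its pullbacks to the open slices \<open>S \<times> {d}\<close>.\<close>

lemma continuous_map_prod_discrete:
  assumes "\<And>d. d \<in> D \<Longrightarrow> continuous_map S Y (\<lambda>x. f (x, d))"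
  shows "continuous_map (prod_topology S (discrete_topology D)) Y f"
  unfolding continuous_map_def
proof (intro conjI allI impI)
  show "f \<in> topspace (prod_topology S (discrete_topology D)) \<rightarrow> topspace Y"
    using assms by (fastforce simp: continuous_map_def)
  fix W assume W: "openin Y W"
  have "{z \<in> topspace (prod_topology S (discrete_topology D)). f z \<in> W}
      = (\<Union>d\<in>D. {x \<in> topspace S. f (x, d) \<in> W} \<times> {d})"
    by auto
  moreover have "openin (prod_topology S (discrete_topology D)) ({x \<in> topspace S. f (x, d) \<in> W} \<times> {d})"
    if "d \<in> D" for d
    using assms[OF that] W that by (auto simp: continuous_map_def openin_prod_Times_iff)
  ultimately show "openin (prod_topology S (discrete_topology D))
      {z \<in> topspace (prod_topology S (discrete_topology D)). f z \<in> W}"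
    by (auto intro!: openin_Union)
qed

text \<open>
  Cover \<open>K\<close> by finitely many open sets so small that quotients \<open>u\<inverse> v\<close> within one of them stay in
  \<open>W\<close>. One of them contains the images of two distinct elements \<open>h\<close> and \<open>k\<close> of \<open>H\<close>, and \<open>h\<inverse> k\<close> is as
  wanted. This covers at once the case where \<open>f\<close> has a nontrivial kernel.
\<close>

lemma infinite_group_recurrence:
  assumes H: "group H" "infinite (carrier H)" and K: "compact_group K U" and f: "f \<in> hom H K"
    and W: "openin U W" "\<one>\<^bsub>K\<^esub> \<in> W"
  obtains h where "h \<in> carrier H" "h \<noteq> \<one>\<^bsub>H\<^esub>" "f h \<in> W"
proof -
  interpret f: group_hom H K f
    using assms by (simp add: group_hom_def group_hom_axioms_def compact_group_def topological_group_def)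
  have tg: "topological_group K U" and comp: "compact_space U" and top: "topspace U = carrier K"
    using K by (auto simp: compact_group_def topological_group_def)
  define c where "c = (\<lambda>z. inv\<^bsub>K\<^esub> (fst z) \<otimes>\<^bsub>K\<^esub> snd z)"
  have c: "continuous_map (prod_topology U U) U c"
    unfolding c_def
    by (intro continuous_map_group_mult[OF tg] continuous_map_group_inv[OF tg]
        continuous_map_fst continuous_map_snd)
  have "\<exists>O'. openin U O' \<and> p \<in> O' \<and> (\<forall>u\<in>O'. \<forall>v\<in>O'. c (u, v) \<in> W)" if p: "p \<in> carrier K" for p
  proof -
    have "openin (prod_topology U U) {z \<in> topspace (prod_topology U U). c z \<in> W}"
      using c W(1) by (rule openin_continuous_map_preimage)
    moreover have "(p, p) \<in> {z \<in> topspace (prod_topology U U). c z \<in> W}"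
      using p W top by (simp add: c_def)
    ultimately obtain A B where "openin U A" "openin U B" "p \<in> A" "p \<in> B"
      "A \<times> B \<subseteq> {z \<in> topspace (prod_topology U U). c z \<in> W}"
      unfolding openin_prod_topology_alt by meson
    then show ?thesis by (intro exI[of _ "A \<inter> B"]) auto
  qed
  then obtain N where N: "\<And>p. p \<in> carrier K \<Longrightarrow> openin U (N p)" "\<And>p. p \<in> carrier K \<Longrightarrow> p \<in> N p"
    "\<And>p u v. p \<in> carrier K \<Longrightarrow> u \<in> N p \<Longrightarrow> v \<in> N p \<Longrightarrow> c (u, v) \<in> W"
    by metis
  obtain \<F> where \<F>: "finite \<F>" "\<F> \<subseteq> N ` carrier K" "carrier K \<subseteq> \<Union>\<F>"
  proof -
    have "\<forall>S\<in>N ` carrier K. openin U S" "topspace U \<subseteq> \<Union>(N ` carrier K)"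
      using N(1,2) top by auto
    then have "\<exists>\<F>. finite \<F> \<and> \<F> \<subseteq> N ` carrier K \<and> topspace U \<subseteq> \<Union>\<F>"
      using comp[unfolded compact_space_alt, rule_format, of "N ` carrier K"] by blast
    then show thesis
      using that top by auto
  qed
  have "carrier H \<subseteq> (\<Union>S\<in>\<F>. {h \<in> carrier H. f h \<in> S})"
  proof
    fix h assume h: "h \<in> carrier H"
    then have "f h \<in> \<Union>\<F>" using \<F>(3) f.hom_closed by blast
    then show "h \<in> (\<Union>S\<in>\<F>. {h \<in> carrier H. f h \<in> S})" using h by blast
  qed
  then obtain S where S: "S \<in> \<F>" "infinite {h \<in> carrier H. f h \<in> S}"
    using \<F>(1) H(2) by (meson finite_UN_I finite_subset)
  obtain p where p: "p \<in> carrier K" "S = N p"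
    using S(1) \<F>(2) by auto
  obtain h where h: "h \<in> carrier H" "f h \<in> S"
    using S(2) not_finite_existsD by blast
  obtain k where k: "k \<in> carrier H" "f k \<in> S" "k \<noteq> h"
  proof -
    have "{h \<in> carrier H. f h \<in> S} - {h} \<noteq> {}"
      using S(2) by (metis (no_types, lifting) finite.emptyI infinite_remove)
    then show thesis using that by blast
  qed
  show thesis
  proof
    show "inv\<^bsub>H\<^esub> h \<otimes>\<^bsub>H\<^esub> k \<in> carrier H" using h k by simp
    show "inv\<^bsub>H\<^esub> h \<otimes>\<^bsub>H\<^esub> k \<noteq> \<one>\<^bsub>H\<^esub>"
      using h k by (metis f.G.inv_solve_left f.G.one_closed f.G.r_one)
    show "f (inv\<^bsub>H\<^esub> h \<otimes>\<^bsub>H\<^esub> k) \<in> W"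
      using N(3)[OF p(1), of "f h" "f k"] h k p by (simp add: c_def)
  qed
qed

section \<open>Elements of wreath products\<close>

text \<open>
  The values of \<open>x\<close> outside \<open>F\<close> are ignored, so \<open>base_element \<Lambda> H {a} (\<lambda>_. l)\<close> is the element \<open>l\<close> of
  \<open>\<Lambda>\<close> placed at the coordinate \<open>a\<close>, and finitely supported families can be built up by induction on
  \<open>F\<close>.
\<close>

definition base_element ::
  "('a, 'm) monoid_scheme \<Rightarrow> ('h, 'q) monoid_scheme \<Rightarrow> 'h set \<Rightarrow> ('h \<Rightarrow> 'a) \<Rightarrow> ('h \<Rightarrow> 'a) \<times> 'h"
  where "base_element \<Lambda> H F x = (\<lambda>b\<in>carrier H. if b \<in> F then x b else \<one>\<^bsub>\<Lambda>\<^esub>, \<one>\<^bsub>H\<^esub>)"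

lemma wreath_mult:
  "(x, h) \<otimes>\<^bsub>wreath_product \<Lambda> H\<^esub> (y, k)
    = (\<lambda>b\<in>carrier H. x b \<otimes>\<^bsub>\<Lambda>\<^esub> y (inv\<^bsub>H\<^esub> h \<otimes>\<^bsub>H\<^esub> b), h \<otimes>\<^bsub>H\<^esub> k)"
  by (simp add: wreath_product_def semidirect_product_def shift_action_def cong: restrict_cong)

lemma wreath_one: "\<one>\<^bsub>wreath_product \<Lambda> H\<^esub> = (\<lambda>b\<in>carrier H. \<one>\<^bsub>\<Lambda>\<^esub>, \<one>\<^bsub>H\<^esub>)"
  by (simp add: wreath_product_def semidirect_product_def)

lemma wreath_carrier:
  assumes "group \<Lambda>"
  shows "(x, h) \<in> carrier (wreath_product \<Lambda> H) \<longleftrightarrow>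
    x \<in> carrier H \<rightarrow>\<^sub>E carrier \<Lambda> \<and> finite {b \<in> carrier H. x b \<noteq> \<one>\<^bsub>\<Lambda>\<^esub>} \<and> h \<in> carrier H"
  using assms by (auto simp: wreath_product_def semidirect_product_def carrier_sum_group)

context
  fixes \<Lambda> :: "('a, 'm) monoid_scheme" and H :: "('h, 'q) monoid_scheme"
  assumes grp: "group \<Lambda>" "group H"
begin

interpretation \<Lambda>: group \<Lambda> by (rule grp)
interpretation H: group H by (rule grp)

lemma base_element_closed:
  assumes "finite F" "\<And>b. b \<in> F \<Longrightarrow> x b \<in> carrier \<Lambda>"
  shows "base_element \<Lambda> H F x \<in> carrier (wreath_product \<Lambda> H)"
proof -
  show ?thesis
    using assms(2) finite_subset[OF _ assms(1), of "{b. x b \<noteq> \<one>\<^bsub>\<Lambda>\<^esub> \<and> b \<in> carrier H \<and> b \<in> F}"]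
    by (auto simp: base_element_def wreath_carrier[OF grp(1)] cong: rev_conj_cong)
qed

lemma acting_element_closed:
  "h \<in> carrier H \<Longrightarrow> (\<lambda>b\<in>carrier H. \<one>\<^bsub>\<Lambda>\<^esub>, h) \<in> carrier (wreath_product \<Lambda> H)"
  by (auto simp: wreath_carrier[OF grp(1)] cong: rev_conj_cong)

lemma base_element_mult:
  assumes "\<And>b. b \<in> F \<Longrightarrow> x b \<in> carrier \<Lambda>" "\<And>b. b \<in> F \<Longrightarrow> y b \<in> carrier \<Lambda>"
  shows "base_element \<Lambda> H F x \<otimes>\<^bsub>wreath_product \<Lambda> H\<^esub> base_element \<Lambda> H F y
    = base_element \<Lambda> H F (\<lambda>b. x b \<otimes>\<^bsub>\<Lambda>\<^esub> y b)"
  using assms by (auto simp: base_element_def wreath_mult)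

lemma base_element_union:
  assumes "F \<inter> F' = {}" "\<And>b. b \<in> F \<union> F' \<Longrightarrow> x b \<in> carrier \<Lambda>"
  shows "base_element \<Lambda> H F x \<otimes>\<^bsub>wreath_product \<Lambda> H\<^esub> base_element \<Lambda> H F' x
    = base_element \<Lambda> H (F \<union> F') x"
  using assms by (auto simp: base_element_def wreath_mult fun_eq_iff)

lemma acting_element_hom:
  "(\<lambda>h. (\<lambda>b\<in>carrier H. \<one>\<^bsub>\<Lambda>\<^esub>, h)) \<in> hom H (wreath_product \<Lambda> H)"
  by (auto simp: hom_def acting_element_closed wreath_mult)

lemma coordinate_hom:
  "(\<lambda>l. base_element \<Lambda> H {a} (\<lambda>_. l)) \<in> hom \<Lambda> (wreath_product \<Lambda> H)"
  by (auto simp: hom_def base_element_closed base_element_mult)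

text \<open>
  The two relations on which the case of infinite \<open>H\<close> rests: distinct coordinates commute, and
  conjugation by \<open>h \<in> H\<close> moves the coordinate \<open>a\<close> to \<open>ha\<close>.
\<close>

lemma coordinates_commute:
  assumes "a \<noteq> b" "l \<in> carrier \<Lambda>" "m \<in> carrier \<Lambda>"
  shows "base_element \<Lambda> H {a} (\<lambda>_. l) \<otimes>\<^bsub>wreath_product \<Lambda> H\<^esub> base_element \<Lambda> H {b} (\<lambda>_. m)
    = base_element \<Lambda> H {b} (\<lambda>_. m) \<otimes>\<^bsub>wreath_product \<Lambda> H\<^esub> base_element \<Lambda> H {a} (\<lambda>_. l)"
  using assms by (auto simp: base_element_def wreath_mult)

lemma acting_element_moves_coordinate:
  assumes "a \<in> carrier H" "h \<in> carrier H" "l \<in> carrier \<Lambda>"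
  shows "(\<lambda>b\<in>carrier H. \<one>\<^bsub>\<Lambda>\<^esub>, h) \<otimes>\<^bsub>wreath_product \<Lambda> H\<^esub> base_element \<Lambda> H {a} (\<lambda>_. l)
    = base_element \<Lambda> H {h \<otimes>\<^bsub>H\<^esub> a} (\<lambda>_. l) \<otimes>\<^bsub>wreath_product \<Lambda> H\<^esub> (\<lambda>b\<in>carrier H. \<one>\<^bsub>\<Lambda>\<^esub>, h)"
proof -
  have "inv\<^bsub>H\<^esub> h \<otimes>\<^bsub>H\<^esub> b = a \<longleftrightarrow> b = h \<otimes>\<^bsub>H\<^esub> a" if "b \<in> carrier H" for b
    using assms that by (metis H.inv_solve_left)
  then show ?thesis
    using assms by (auto simp: base_element_def wreath_mult)
qed

lemma wreath_decompose:
  assumes g: "(x, h) \<in> carrier (wreath_product \<Lambda> H)" and F: "{b \<in> carrier H. x b \<noteq> \<one>\<^bsub>\<Lambda>\<^esub>} \<subseteq> F"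
  shows "(x, h) = base_element \<Lambda> H F x \<otimes>\<^bsub>wreath_product \<Lambda> H\<^esub> (\<lambda>b\<in>carrier H. \<one>\<^bsub>\<Lambda>\<^esub>, h)"
proof -
  have "x = (\<lambda>b\<in>carrier H. (\<lambda>b\<in>carrier H. if b \<in> F then x b else \<one>\<^bsub>\<Lambda>\<^esub>) b \<otimes>\<^bsub>\<Lambda>\<^esub>
      (\<lambda>b\<in>carrier H. \<one>\<^bsub>\<Lambda>\<^esub>) (inv\<^bsub>H\<^esub> \<one>\<^bsub>H\<^esub> \<otimes>\<^bsub>H\<^esub> b))"
    using g F by (auto simp: wreath_carrier[OF grp(1)] fun_eq_iff PiE_iff extensional_def)
  moreover have "h \<in> carrier H" using g by (simp add: wreath_carrier[OF grp(1)])
  ultimately show ?thesis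
    by (simp add: base_element_def wreath_mult)
qed

section \<open>Homomorphisms to compact groups when \<open>H\<close> is infinite\<close>

text \<open>
  If \<open>\<delta> l\<close> and \<open>\<delta> m\<close> did not commute, then \<open>\<delta> l\<close> would not commute with \<open>k (\<delta> m) k\<inverse>\<close> either, for all
  \<open>k\<close> in some neighbourhood of the identity. By recurrence that neighbourhood contains the image of
  some \<open>h \<noteq> 1\<close>, for which the conjugate is the image of \<open>m\<close> placed at the other coordinate \<open>ha\<close>.
\<close>

lemma coordinate_image_commutes:
  assumes inf: "infinite (carrier H)" and K: "compact_group K U"
    and f: "f \<in> hom (wreath_product \<Lambda> H) K"
    and a: "a \<in> carrier H" and lm: "l \<in> carrier \<Lambda>" "m \<in> carrier \<Lambda>"
  defines "\<delta> \<equiv> (\<lambda>l. f (base_element \<Lambda> H {a} (\<lambda>_. l)))"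
  shows "\<delta> l \<otimes>\<^bsub>K\<^esub> \<delta> m = \<delta> m \<otimes>\<^bsub>K\<^esub> \<delta> l"
proof (rule ccontr)
  assume neq: "\<delta> l \<otimes>\<^bsub>K\<^esub> \<delta> m \<noteq> \<delta> m \<otimes>\<^bsub>K\<^esub> \<delta> l"
  let ?W = "wreath_product \<Lambda> H"
  have tg: "topological_group K U" and haus: "Hausdorff_space U" and top: "topspace U = carrier K"
    using K by (auto simp: compact_group_def topological_group_def)
  interpret K: group K using tg by (simp add: topological_group_def)
  define s where "s = (\<lambda>h. f (\<lambda>b\<in>carrier H. \<one>\<^bsub>\<Lambda>\<^esub>, h))"
  have s: "s \<in> hom H K"
    unfolding s_def using hom_compose[OF acting_element_hom f] by (simp add: o_def)
  have \<delta>: "\<delta> l \<in> carrier K" if "l \<in> carrier \<Lambda>" for l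
    unfolding \<delta>_def using that by (intro hom_in_carrier[OF f] base_element_closed) auto
  define e1 where "e1 = (\<lambda>k. \<delta> l \<otimes>\<^bsub>K\<^esub> (k \<otimes>\<^bsub>K\<^esub> \<delta> m \<otimes>\<^bsub>K\<^esub> inv\<^bsub>K\<^esub> k))"
  define e2 where "e2 = (\<lambda>k. (k \<otimes>\<^bsub>K\<^esub> \<delta> m \<otimes>\<^bsub>K\<^esub> inv\<^bsub>K\<^esub> k) \<otimes>\<^bsub>K\<^esub> \<delta> l)"
  have cont: "continuous_map U U e1" "continuous_map U U e2"
    unfolding e1_def e2_def using \<delta> lm top
    by (intro continuous_map_group_mult[OF tg] continuous_map_group_inv[OF tg]; simp)+
  have "closedin U {k \<in> topspace U. e1 k = e2 k}"
    by (rule closedin_continuous_maps_eq[OF haus cont])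
  then have W: "openin U (topspace U - {k \<in> topspace U. e1 k = e2 k})" by (simp add: closedin_def)
  have one: "\<one>\<^bsub>K\<^esub> \<in> topspace U - {k \<in> topspace U. e1 k = e2 k}"
    using neq lm \<delta> top by (simp add: e1_def e2_def)
  obtain h where h: "h \<in> carrier H" "h \<noteq> \<one>\<^bsub>H\<^esub>" "s h \<in> topspace U - {k \<in> topspace U. e1 k = e2 k}"
    by (rule infinite_group_recurrence[OF grp(2) inf K s W one])
  define y where "y = f (base_element \<Lambda> H {h \<otimes>\<^bsub>H\<^esub> a} (\<lambda>_. m))"
  have y: "y \<in> carrier K"
    unfolding y_def using lm by (intro hom_in_carrier[OF f] base_element_closed) auto
  have sh: "s h \<in> carrier K" using h s by (auto intro: hom_in_carrier)
  have "s h \<otimes>\<^bsub>K\<^esub> \<delta> m = y \<otimes>\<^bsub>K\<^esub> s h"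
    unfolding s_def \<delta>_def y_def using lm a h(1)
    by (simp add: base_element_closed acting_element_closed acting_element_moves_coordinate flip: hom_mult[OF f])
  then have conj: "s h \<otimes>\<^bsub>K\<^esub> \<delta> m \<otimes>\<^bsub>K\<^esub> inv\<^bsub>K\<^esub> (s h) = y"
    using y sh by (simp add: K.m_assoc)
  \<comment> \<open>Here \<open>h \<noteq> 1\<close> enters: the conjugate sits at a coordinate different from \<open>a\<close>.\<close>
  have "h \<otimes>\<^bsub>H\<^esub> a \<noteq> a" using h a by simp
  then have "\<delta> l \<otimes>\<^bsub>K\<^esub> y = y \<otimes>\<^bsub>K\<^esub> \<delta> l"
    unfolding \<delta>_def y_def using lm coordinates_commute[of "h \<otimes>\<^bsub>H\<^esub> a" a m l]
    by (simp add: base_element_closed flip: hom_mult[OF f])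
  then have "e1 (s h) = e2 (s h)" by (simp add: e1_def e2_def conj)
  then show False using h(3) by blast
qed


text \<open>
  Restricted to one coordinate, \<open>f\<close> is a homomorphism with commutative image, so its kernel contains
  \<open>[\<Lambda>, \<Lambda>]\<close>. A finitely supported family is a product of elements placed at single coordinates.
\<close>

lemma commutator_base_element_dies:
  assumes inf: "infinite (carrier H)" and K: "compact_group K U"
    and f: "f \<in> hom (wreath_product \<Lambda> H) K"
    and F: "finite F" "F \<subseteq> carrier H" "\<And>b. b \<in> F \<Longrightarrow> x b \<in> commutator_subgroup \<Lambda>"
  shows "f (base_element \<Lambda> H F x) = \<one>\<^bsub>K\<^esub>"
proof -
  interpret W: group "wreath_product \<Lambda> H" using grp by (rule group_wreath_product)
  interpret K: group K using K by (simp add: compact_group_def topological_group_def)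
  interpret f: group_hom "wreath_product \<Lambda> H" K f
    using f by unfold_locales
  have coord: "f (base_element \<Lambda> H {a} (\<lambda>_. l)) = \<one>\<^bsub>K\<^esub>"
    if a: "a \<in> carrier H" and l: "l \<in> commutator_subgroup \<Lambda>" for a l
  proof -
    define \<delta> where "\<delta> = (\<lambda>l. f (base_element \<Lambda> H {a} (\<lambda>_. l)))"
    have "\<delta> \<in> hom \<Lambda> K"
      unfolding \<delta>_def using hom_compose[OF coordinate_hom f] by (simp add: o_def)
    then interpret \<delta>: group_hom \<Lambda> K \<delta> by unfold_locales
    have "\<delta> (u \<otimes>\<^bsub>\<Lambda>\<^esub> v \<otimes>\<^bsub>\<Lambda>\<^esub> inv\<^bsub>\<Lambda>\<^esub> u \<otimes>\<^bsub>\<Lambda>\<^esub> inv\<^bsub>\<Lambda>\<^esub> v) = \<one>\<^bsub>K\<^esub>"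
      if uv: "u \<in> carrier \<Lambda>" "v \<in> carrier \<Lambda>" for u v
    proof -
      have "\<delta> u \<otimes>\<^bsub>K\<^esub> \<delta> v = \<delta> v \<otimes>\<^bsub>K\<^esub> \<delta> u"
        unfolding \<delta>_def by (rule coordinate_image_commutes[OF inf K f a uv])
      then show ?thesis using uv by (simp add: K.m_assoc)
    qed
    then have "derived_set \<Lambda> (carrier \<Lambda>) \<subseteq> kernel \<Lambda> K \<delta>"
      by (auto simp: kernel_def)
    then have "commutator_subgroup \<Lambda> \<subseteq> kernel \<Lambda> K \<delta>"
      unfolding commutator_subgroup_def derived_def
      by (rule \<Lambda>.generate_subgroup_incl) (rule \<delta>.subgroup_kernel)
    then show ?thesis using l by (auto simp: kernel_def \<delta>_def)
  qed
  have D: "commutator_subgroup \<Lambda> \<subseteq> carrier \<Lambda>"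
    unfolding commutator_subgroup_def by (rule \<Lambda>.derived_in_carrier) simp
  show ?thesis
    using F
  proof (induction F rule: finite_induct)
    case empty
    have "base_element \<Lambda> H {} x = \<one>\<^bsub>wreath_product \<Lambda> H\<^esub>"
      by (simp add: base_element_def wreath_one)
    then show ?case by simp
  next
    case (insert a F)
    have xD: "x b \<in> carrier \<Lambda>" if "b \<in> insert a F" for b
      using insert.prems that D by blast
    have "base_element \<Lambda> H (insert a F) x
        = base_element \<Lambda> H {a} x \<otimes>\<^bsub>wreath_product \<Lambda> H\<^esub> base_element \<Lambda> H F x"
      using base_element_union[of "{a}" F x] insert.hyps xD by simp
    moreover have "base_element \<Lambda> H {a} x = base_element \<Lambda> H {a} (\<lambda>_. x a)"
      by (auto simp: base_element_def fun_eq_iff)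
    ultimately show ?case
      using insert xD coord[of a "x a"] by (simp add: base_element_closed)
  qed
qed

lemma commutator_families_die:
  assumes inf: "infinite (carrier H)" and K: "compact_group K U"
    and f: "f \<in> hom (wreath_product \<Lambda> H) K"
    and g: "(x, \<one>\<^bsub>H\<^esub>) \<in> carrier (wreath_product \<Lambda> H)"
    and x: "\<And>b. b \<in> carrier H \<Longrightarrow> x b \<in> commutator_subgroup \<Lambda>"
  shows "f (x, \<one>\<^bsub>H\<^esub>) = \<one>\<^bsub>K\<^esub>"
proof -
  interpret W: group "wreath_product \<Lambda> H" using grp by (rule group_wreath_product)
  let ?F = "{b \<in> carrier H. x b \<noteq> \<one>\<^bsub>\<Lambda>\<^esub>}"
  have xc: "x b \<in> carrier \<Lambda>" if "b \<in> carrier H" for b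
    using g that by (auto simp: wreath_carrier[OF grp(1)])
  have F: "finite ?F" "?F \<subseteq> carrier H"
    using g by (auto simp: wreath_carrier[OF grp(1)])
  have "(x, \<one>\<^bsub>H\<^esub>) = base_element \<Lambda> H ?F x \<otimes>\<^bsub>wreath_product \<Lambda> H\<^esub> \<one>\<^bsub>wreath_product \<Lambda> H\<^esub>"
    unfolding wreath_one by (rule wreath_decompose[OF g order_refl])
  also have "\<dots> = base_element \<Lambda> H ?F x"
    using F(1) xc by (intro W.r_one base_element_closed) auto
  finally show ?thesis
    using commutator_base_element_dies[OF inf K f F] x by simp
qed

end

section \<open>Maps between wreath products\<close>

definition wreath_map :: "('h, 'q) monoid_scheme \<Rightarrow> ('a \<Rightarrow> 'b) \<Rightarrow> ('h \<Rightarrow> 'a) \<times> 'h \<Rightarrow> ('h \<Rightarrow> 'b) \<times> 'h"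
  where "wreath_map H p = (\<lambda>(x, h). (\<lambda>b\<in>carrier H. p (x b), h))"

lemma wreath_map_hom:
  assumes "group \<Lambda>" "group \<Gamma>" "group H" and p: "p \<in> hom \<Lambda> \<Gamma>"
  shows "wreath_map H p \<in> hom (wreath_product \<Lambda> H) (wreath_product \<Gamma> H)"
proof -
  interpret H: group H by fact
  interpret p: group_hom \<Lambda> \<Gamma> p using assms by (simp add: group_hom_def group_hom_axioms_def)
  show ?thesis
  proof (rule homI, goal_cases)
    case (1 g)
    obtain x h where g: "g = (x, h)" by force
    have "finite {b \<in> carrier H. p (x b) \<noteq> \<one>\<^bsub>\<Gamma>\<^esub>}"
      by (rule finite_subset[of _ "{b \<in> carrier H. x b \<noteq> \<one>\<^bsub>\<Lambda>\<^esub>}"])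
        (use 1 g in \<open>auto simp: wreath_carrier assms\<close>)
    then show ?case
      using 1 g by (auto simp: wreath_map_def wreath_carrier assms PiE_iff cong: conj_cong)
  next
    case (2 g k)
    obtain x h y l where "g = (x, h)" "k = (y, l)" by force
    with 2 show ?case
      by (auto simp: wreath_map_def wreath_carrier assms wreath_mult PiE_iff fun_eq_iff)
  qed
qed

lemma wreath_map_surj:
  assumes "group \<Lambda>" "group \<Gamma>" "group H" and p: "p \<in> hom \<Lambda> \<Gamma>" "p ` carrier \<Lambda> = carrier \<Gamma>"
  shows "wreath_map H p ` carrier (wreath_product \<Lambda> H) = carrier (wreath_product \<Gamma> H)"
proof
  show "wreath_map H p ` carrier (wreath_product \<Lambda> H) \<subseteq> carrier (wreath_product \<Gamma> H)"
    using hom_in_carrier[OF wreath_map_hom[OF assms(1-4)]] by auto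
  interpret p: group_hom \<Lambda> \<Gamma> p using assms by (simp add: group_hom_def group_hom_axioms_def)
  \<comment> \<open>The lifts must send the identity to the identity, or lifted families could have infinite support.\<close>
  define r where "r = (\<lambda>c. if c = \<one>\<^bsub>\<Gamma>\<^esub> then \<one>\<^bsub>\<Lambda>\<^esub> else inv_into (carrier \<Lambda>) p c)"
  have r: "r c \<in> carrier \<Lambda>" "p (r c) = c" if "c \<in> carrier \<Gamma>" for c
    using that p(2) by (auto simp: r_def inv_into_into f_inv_into_f)
  have "(y, h) \<in> wreath_map H p ` carrier (wreath_product \<Lambda> H)"
    if "(y, h) \<in> carrier (wreath_product \<Gamma> H)" for y h
  proof (rule image_eqI)
    have y: "y \<in> carrier H \<rightarrow>\<^sub>E carrier \<Gamma>" "finite {b \<in> carrier H. y b \<noteq> \<one>\<^bsub>\<Gamma>\<^esub>}" "h \<in> carrier H"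
      using that by (auto simp: wreath_carrier assms)
    have "finite {b \<in> carrier H. r (y b) \<noteq> \<one>\<^bsub>\<Lambda>\<^esub>}"
      by (rule finite_subset[OF _ y(2)]) (auto simp: r_def)
    then show "(\<lambda>b\<in>carrier H. r (y b), h) \<in> carrier (wreath_product \<Lambda> H)"
      using y r by (auto simp: wreath_carrier assms PiE_iff cong: conj_cong)
    show "(y, h) = wreath_map H p (\<lambda>b\<in>carrier H. r (y b), h)"
      using y r by (auto simp: wreath_map_def fun_eq_iff PiE_iff extensional_def)
  qed
  then show "carrier (wreath_product \<Gamma> H) \<subseteq> wreath_map H p ` carrier (wreath_product \<Lambda> H)"
    by auto
qed

lemma wreath_abelianization_map:
  assumes "group \<Lambda>" "group H"
  shows "wreath_abelianization_map \<Lambda> H \<in> hom (wreath_product \<Lambda> H) (wreath_product (abelianization \<Lambda>) H)"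
    and "wreath_abelianization_map \<Lambda> H ` carrier (wreath_product \<Lambda> H)
      = carrier (wreath_product (abelianization \<Lambda>) H)"
    and "\<And>x h. (x, h) \<in> carrier (wreath_product \<Lambda> H) \<Longrightarrow>
      wreath_abelianization_map \<Lambda> H (x, h) = \<one>\<^bsub>wreath_product (abelianization \<Lambda>) H\<^esub> \<Longrightarrow>
      h = \<one>\<^bsub>H\<^esub> \<and> (\<forall>b\<in>carrier H. x b \<in> commutator_subgroup \<Lambda>)"
proof -
  interpret \<Lambda>: group \<Lambda> by fact
  interpret D: normal "commutator_subgroup \<Lambda>" \<Lambda>
    unfolding commutator_subgroup_def by (rule \<Lambda>.derived_self_is_normal)
  have p: "(\<lambda>l. commutator_subgroup \<Lambda> #>\<^bsub>\<Lambda>\<^esub> l) \<in> hom \<Lambda> (abelianization \<Lambda>)"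
    unfolding abelianization_def by (rule D.r_coset_hom_Mod)
  have ab: "group (abelianization \<Lambda>)"
    unfolding abelianization_def by (rule D.factorgroup_is_group)
  have eq: "wreath_abelianization_map \<Lambda> H = wreath_map H (\<lambda>l. commutator_subgroup \<Lambda> #>\<^bsub>\<Lambda>\<^esub> l)"
    by (simp add: wreath_abelianization_map_def wreath_map_def)
  show "wreath_abelianization_map \<Lambda> H \<in> hom (wreath_product \<Lambda> H) (wreath_product (abelianization \<Lambda>) H)"
    unfolding eq by (rule wreath_map_hom[OF assms(1) ab assms(2) p])
  show "wreath_abelianization_map \<Lambda> H ` carrier (wreath_product \<Lambda> H)
      = carrier (wreath_product (abelianization \<Lambda>) H)"
    unfolding eq
    by (rule wreath_map_surj[OF assms(1) ab assms(2) p]) (simp add: abelianization_def carrier_FactGroup)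
  fix x h assume xh: "(x, h) \<in> carrier (wreath_product \<Lambda> H)"
    and one: "wreath_abelianization_map \<Lambda> H (x, h) = \<one>\<^bsub>wreath_product (abelianization \<Lambda>) H\<^esub>"
  have "x b \<in> commutator_subgroup \<Lambda>" if b: "b \<in> carrier H" for b
  proof -
    have "commutator_subgroup \<Lambda> #>\<^bsub>\<Lambda>\<^esub> x b = commutator_subgroup \<Lambda>"
      using fun_cong[OF arg_cong[OF one, of fst], of b] b
      by (simp add: wreath_abelianization_map_def wreath_one abelianization_def)
    moreover have "x b \<in> carrier \<Lambda>" using xh b by (auto simp: wreath_carrier assms)
    ultimately show ?thesis using \<Lambda>.coset_join1 D.subgroup_axioms D.subset by blast
  qed
  then show "h = \<one>\<^bsub>H\<^esub> \<and> (\<forall>b\<in>carrier H. x b \<in> commutator_subgroup \<Lambda>)"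
    using one by (simp add: wreath_abelianization_map_def wreath_one)
qed

lemma wreath_snd:
  assumes "group \<Lambda>" "group H"
  shows "snd \<in> hom (wreath_product \<Lambda> H) H" "snd ` carrier (wreath_product \<Lambda> H) = carrier H"
proof -
  show "snd \<in> hom (wreath_product \<Lambda> H) H"
    by (auto simp: hom_def wreath_carrier assms wreath_mult)
  show "snd ` carrier (wreath_product \<Lambda> H) = carrier H"
  proof
    show "snd ` carrier (wreath_product \<Lambda> H) \<subseteq> carrier H"
      by (auto simp: wreath_carrier assms)
    show "carrier H \<subseteq> snd ` carrier (wreath_product \<Lambda> H)"
    proof
      fix h assume "h \<in> carrier H"
      then show "h \<in> snd ` carrier (wreath_product \<Lambda> H)"
        using acting_element_closed[OF assms] by (intro image_eqI) auto
    qed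
  qed
qed

section \<open>Quotients with the same completion\<close>

text \<open>
  Since \<open>\<kappa>\<close> kills the kernel of \<open>q\<close>, it descends to a homomorphism on \<open>Q\<close>, whose extension to \<open>L\<close>
  inverts the induced map. The universal properties are stated towards the groups \<open>K\<close> and \<open>L\<close>
  themselves; in this form Bohr compactifications and profinite completions share them.
\<close>

lemma completion_iso_of_quotient:
  assumes G: "group G" "group Q" "q \<in> hom G Q" "q ` carrier G = carrier Q"
    and K: "compact_group K U" "\<kappa> \<in> hom G K" "U closure_of (\<kappa> ` carrier G) = carrier K"
    and L: "compact_group L V" "\<eta> \<in> hom Q L" "V closure_of (\<eta> ` carrier Q) = carrier L"
    and kill: "\<And>g. g \<in> carrier G \<Longrightarrow> q g = \<one>\<^bsub>Q\<^esub> \<Longrightarrow> \<kappa> g = \<one>\<^bsub>K\<^esub>"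
    and univK: "\<And>f. continuous_hom G (discrete_top G) L V f \<Longrightarrow>
      \<exists>\<phi>. continuous_hom K U L V \<phi> \<and> (\<forall>g\<in>carrier G. \<phi> (\<kappa> g) = f g)"
    and univL: "\<And>f. continuous_hom Q (discrete_top Q) K U f \<Longrightarrow>
      \<exists>\<psi>. continuous_hom L V K U \<psi> \<and> (\<forall>c\<in>carrier Q. \<psi> (\<eta> c) = f c)"
  shows "\<exists>\<phi>. induced_map G q K U \<kappa> L V \<eta> \<phi> \<and> topological_iso K U L V \<phi>"
proof -
  have top: "topspace U = carrier K" "topspace V = carrier L" "Hausdorff_space U" "Hausdorff_space V"
    using K(1) L(1) by (auto simp: compact_group_def topological_group_def)
  interpret q: group_hom G Q q using G by (simp add: group_hom_def group_hom_axioms_def)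
  interpret \<kappa>: group_hom G K \<kappa>
    using G K by (simp add: group_hom_def group_hom_axioms_def compact_group_def topological_group_def)
  have eq: "\<kappa> g = \<kappa> h" if gh: "g \<in> carrier G" "h \<in> carrier G" "q g = q h" for g h
  proof -
    have "q (g \<otimes>\<^bsub>G\<^esub> inv\<^bsub>G\<^esub> h) = \<one>\<^bsub>Q\<^esub>" using gh by simp
    then have "\<kappa> (g \<otimes>\<^bsub>G\<^esub> inv\<^bsub>G\<^esub> h) = \<one>\<^bsub>K\<^esub>" using gh by (intro kill) auto
    then have "\<kappa> g \<otimes>\<^bsub>K\<^esub> inv\<^bsub>K\<^esub> (\<kappa> h) = \<one>\<^bsub>K\<^esub>" using gh by simp
    then show ?thesis using gh by (metis \<kappa>.H.inv_equality \<kappa>.H.inv_inv \<kappa>.H.inv_closed \<kappa>.hom_closed)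
  qed
  define f where "f = (\<lambda>c. \<kappa> (inv_into (carrier G) q c))"
  have f: "f (q g) = \<kappa> g" if "g \<in> carrier G" for g
    unfolding f_def using that by (intro eq) (auto simp: inv_into_into f_inv_into_f)
  have "f \<in> hom Q K"
  proof (rule homI)
    fix c assume "c \<in> carrier Q"
    then obtain g where "g \<in> carrier G" "c = q g" using G(4) by blast
    then show "f c \<in> carrier K" by (simp add: f)
  next
    fix c d assume "c \<in> carrier Q" "d \<in> carrier Q"
    then obtain g h where "g \<in> carrier G" "c = q g" "h \<in> carrier G" "d = q h" using G(4) by blast
    then show "f (c \<otimes>\<^bsub>Q\<^esub> d) = f c \<otimes>\<^bsub>K\<^esub> f d" by (simp add: f flip: q.hom_mult)
  qed
  then have "continuous_hom Q (discrete_top Q) K U f"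
    using top by (auto simp: continuous_hom_def hom_def)
  then obtain \<psi> where \<psi>: "continuous_hom L V K U \<psi>" "\<forall>c\<in>carrier Q. \<psi> (\<eta> c) = f c"
    using univL by blast
  have "\<eta> \<circ> q \<in> hom G L" using G(3) L(2) by (rule hom_compose)
  then have "continuous_hom G (discrete_top G) L V (\<eta> \<circ> q)"
    using top by (auto simp: continuous_hom_def hom_def)
  then obtain \<phi> where \<phi>: "continuous_hom K U L V \<phi>" "\<forall>g\<in>carrier G. \<phi> (\<kappa> g) = (\<eta> \<circ> q) g"
    using univK by blast
  have "V closure_of ((\<eta> \<circ> q) ` carrier G) = carrier L"
    using G(4) L(3) by (simp add: image_comp flip: image_image)
  moreover have "continuous_map V U \<psi>" using \<psi>(1) by (simp add: continuous_hom_def)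
  ultimately have "topological_iso K U L V \<phi>"
    using K(3) \<phi> \<psi> f top
    by (intro topological_iso_of_inverse_on_dense[where \<kappa> = \<kappa> and \<eta> = "\<eta> \<circ> q" and A = "carrier G" and \<psi> = \<psi>]) auto
  then show ?thesis using \<phi> by (auto simp: induced_map_def)
qed

lemma bohr_iso_of_quotient:
  assumes K: "bohr_compactification G (discrete_top G) K U \<kappa>"
    and L: "bohr_compactification Q (discrete_top Q) L V \<eta>"
    and q: "q \<in> hom G Q" "q ` carrier G = carrier Q"
    and kill: "\<And>g. g \<in> carrier G \<Longrightarrow> q g = \<one>\<^bsub>Q\<^esub> \<Longrightarrow> \<kappa> g = \<one>\<^bsub>K\<^esub>"
  shows "\<exists>\<phi>. induced_map G q K U \<kappa> L V \<eta> \<phi> \<and> topological_iso K U L V \<phi>"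
proof (rule completion_iso_of_quotient[OF _ _ q _ _ _ _ _ _ kill])
  have KL: "compact_group K U" "compact_group L V"
    using K L by (simp_all add: bohr_compactification_def)
  show "\<exists>\<phi>. continuous_hom K U L V \<phi> \<and> (\<forall>g\<in>carrier G. \<phi> (\<kappa> g) = f g)"
    if "continuous_hom G (discrete_top G) L V f" for f
    by (rule bohr_compactification_universal[OF K KL(2) that])
  show "\<exists>\<psi>. continuous_hom L V K U \<psi> \<and> (\<forall>c\<in>carrier Q. \<psi> (\<eta> c) = f c)"
    if "continuous_hom Q (discrete_top Q) K U f" for f
    by (rule bohr_compactification_universal[OF L KL(1) that])
qed (use K L in \<open>auto simp: bohr_compactification_def topological_group_def continuous_hom_def\<close>)

lemma profinite_iso_of_quotient:
  assumes K: "profinite_completion G (discrete_top G) K U \<kappa>"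
    and L: "profinite_completion Q (discrete_top Q) L V \<eta>"
    and q: "q \<in> hom G Q" "q ` carrier G = carrier Q"
    and kill: "\<And>g. g \<in> carrier G \<Longrightarrow> q g = \<one>\<^bsub>Q\<^esub> \<Longrightarrow> \<kappa> g = \<one>\<^bsub>K\<^esub>"
  shows "\<exists>\<phi>. induced_map G q K U \<kappa> L V \<eta> \<phi> \<and> topological_iso K U L V \<phi>"
proof (rule completion_iso_of_quotient[OF _ _ q _ _ _ _ _ _ kill])
  have KL: "profinite_group K U" "profinite_group L V"
    using K L by (simp_all add: profinite_completion_def)
  show "\<exists>\<phi>. continuous_hom K U L V \<phi> \<and> (\<forall>g\<in>carrier G. \<phi> (\<kappa> g) = f g)"
    if "continuous_hom G (discrete_top G) L V f" for f
    by (rule profinite_completion_universal[OF K KL(2) that])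
  show "\<exists>\<psi>. continuous_hom L V K U \<psi> \<and> (\<forall>c\<in>carrier Q. \<psi> (\<eta> c) = f c)"
    if "continuous_hom Q (discrete_top Q) K U f" for f
    by (rule profinite_completion_universal[OF L KL(1) that])
qed (use K L in \<open>auto simp: profinite_completion_def profinite_group_def topological_group_def continuous_hom_def\<close>)

section \<open>Wreath products of compact groups with finite groups\<close>

abbreviation (input) wreath_topology :: "('h, 'q) monoid_scheme \<Rightarrow> 'b topology \<Rightarrow> (('h \<Rightarrow> 'b) \<times> 'h) topology"
  where "wreath_topology H V \<equiv> prod_topology (product_topology (\<lambda>_. V) (carrier H)) (discrete_top H)"

lemma topological_group_wreath:
  assumes B: "topological_group B V" and H: "group H" "finite (carrier H)"
  shows "topological_group (wreath_product B H) (wreath_topology H V)"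
proof -
  interpret H: group H by fact
  interpret B: group B using B by (simp add: topological_group_def)
  have top: "topspace V = carrier B" using B by (simp add: topological_group_def)
  have Hd: "topological_group H (discrete_top H)" by (rule topological_group_discrete[OF H(1)])
  let ?T = "wreath_topology H V" and ?P = "product_topology (\<lambda>_. V) (carrier H)"
  let ?W = "wreath_product B H"
  interpret W: group ?W by (rule group_wreath_product) (rule B.group_axioms H.group_axioms)+
  have carr: "carrier ?W = (carrier H \<rightarrow>\<^sub>E carrier B) \<times> carrier H"
    using H(2) by (auto simp: wreath_carrier[OF B.group_axioms])
  have proj: "continuous_map ?P V (\<lambda>x. x b)" if "b \<in> carrier H" for b
    by (rule continuous_map_product_projection[OF that])
  \<comment> \<open>A family may be evaluated continuously at a coordinate that depends on an element of \<open>H\<close>, because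
    that element varies in a discrete space.\<close>
  have ev: "continuous_map T V (\<lambda>z. fst (f z) (\<rho> (snd (f z)) b))"
    if "continuous_map T ?T f" "\<And>h. h \<in> carrier H \<Longrightarrow> \<rho> h b \<in> carrier H" for T f \<rho> b
  proof -
    have "continuous_map ?T V (\<lambda>z. fst z (\<rho> (snd z) b))"
      using that(2) by (intro continuous_map_prod_discrete) (simp add: proj)
    from continuous_map_compose[OF that(1) this] show ?thesis by (simp add: o_def)
  qed
  let ?TT = "prod_topology ?T ?T"
  have c1: "continuous_map ?TT ?T fst" "continuous_map ?TT ?T snd"
    by (rule continuous_map_fst continuous_map_snd)+
  have c2: "continuous_map ?TT ?P (\<lambda>z. fst (fst z))" "continuous_map ?TT (discrete_top H) (\<lambda>z. snd (fst z))"
    "continuous_map ?TT ?P (\<lambda>z. fst (snd z))" "continuous_map ?TT (discrete_top H) (\<lambda>z. snd (snd z))"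
    using continuous_map_compose[OF c1(1) continuous_map_fst] continuous_map_compose[OF c1(1) continuous_map_snd]
      continuous_map_compose[OF c1(2) continuous_map_fst] continuous_map_compose[OF c1(2) continuous_map_snd]
    by (simp_all add: o_def)
  have "continuous_map ?TT V (\<lambda>z. fst (fst z) b \<otimes>\<^bsub>B\<^esub> fst (snd z) (inv\<^bsub>H\<^esub> (snd (fst z)) \<otimes>\<^bsub>H\<^esub> b))"
    if b: "b \<in> carrier H" for b
  proof (rule continuous_map_group_mult[OF B])
    show "continuous_map ?TT V (\<lambda>z. fst (fst z) b)"
      using continuous_map_compose[OF c2(1) proj[OF b]] by (simp add: o_def)
    show "continuous_map ?TT V (\<lambda>z. fst (snd z) (inv\<^bsub>H\<^esub> (snd (fst z)) \<otimes>\<^bsub>H\<^esub> b))"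
      using ev[of ?TT "\<lambda>z. (fst (snd z), snd (fst z))" "\<lambda>h b. inv\<^bsub>H\<^esub> h \<otimes>\<^bsub>H\<^esub> b" b] c2 b
      by (simp add: continuous_map_pairedI)
  qed
  then have "continuous_map ?TT ?P
      (\<lambda>z. \<lambda>b\<in>carrier H. fst (fst z) b \<otimes>\<^bsub>B\<^esub> fst (snd z) (inv\<^bsub>H\<^esub> (snd (fst z)) \<otimes>\<^bsub>H\<^esub> b))"
    by (auto simp: continuous_map_componentwise)
  then have "continuous_map ?TT ?T (\<lambda>z.
      (\<lambda>b\<in>carrier H. fst (fst z) b \<otimes>\<^bsub>B\<^esub> fst (snd z) (inv\<^bsub>H\<^esub> (snd (fst z)) \<otimes>\<^bsub>H\<^esub> b),
       snd (fst z) \<otimes>\<^bsub>H\<^esub> snd (snd z)))"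
    using c2 by (intro continuous_map_pairedI continuous_map_group_mult[OF Hd])
  moreover have "(\<lambda>z. (\<lambda>b\<in>carrier H. fst (fst z) b \<otimes>\<^bsub>B\<^esub> fst (snd z) (inv\<^bsub>H\<^esub> (snd (fst z)) \<otimes>\<^bsub>H\<^esub> b),
       snd (fst z) \<otimes>\<^bsub>H\<^esub> snd (snd z))) = (\<lambda>(p, r). p \<otimes>\<^bsub>?W\<^esub> r)"
    by (auto simp: wreath_mult)
  ultimately have mult: "continuous_map ?TT ?T (\<lambda>(p, r). p \<otimes>\<^bsub>?W\<^esub> r)" by simp
  have "continuous_map ?T V (\<lambda>z. inv\<^bsub>B\<^esub> (fst z (snd z \<otimes>\<^bsub>H\<^esub> b)))" if b: "b \<in> carrier H" for b
    using ev[of ?T "\<lambda>z. z" "\<lambda>h b. h \<otimes>\<^bsub>H\<^esub> b" b] b by (intro continuous_map_group_inv[OF B]) simp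
  then have "continuous_map ?T ?P (\<lambda>z. \<lambda>b\<in>carrier H. inv\<^bsub>B\<^esub> (fst z (snd z \<otimes>\<^bsub>H\<^esub> b)))"
    by (auto simp: continuous_map_componentwise)
  then have "continuous_map ?T ?T
      (\<lambda>z. (\<lambda>b\<in>carrier H. inv\<^bsub>B\<^esub> (fst z (snd z \<otimes>\<^bsub>H\<^esub> b)), inv\<^bsub>H\<^esub> (snd z)))"
    by (intro continuous_map_pairedI continuous_map_group_inv[OF Hd] continuous_map_snd)
  then have "continuous_map ?T ?T (\<lambda>z. inv\<^bsub>?W\<^esub> z)"
  proof (rule continuous_map_eq)
    fix z assume "z \<in> topspace ?T"
    then obtain x h where z: "z = (x, h)" "x \<in> carrier H \<rightarrow>\<^sub>E carrier B" "h \<in> carrier H"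
      using top by auto
    have "inv\<^bsub>?W\<^esub> z = (\<lambda>b\<in>carrier H. inv\<^bsub>B\<^esub> (x (h \<otimes>\<^bsub>H\<^esub> b)), inv\<^bsub>H\<^esub> h)"
      by (rule W.inv_equality) (use z in \<open>auto simp: carr wreath_mult wreath_one PiE_iff\<close>)
    then show "(\<lambda>b\<in>carrier H. inv\<^bsub>B\<^esub> (fst z (snd z \<otimes>\<^bsub>H\<^esub> b)), inv\<^bsub>H\<^esub> (snd z)) = inv\<^bsub>?W\<^esub> z"
      using z by simp
  qed
  then show ?thesis
    using mult W.group_axioms top by (simp add: topological_group_def carr)
qed

lemma compact_group_wreath:
  assumes B: "compact_group B V" and H: "group H" "finite (carrier H)"
  shows "compact_group (wreath_product B H) (wreath_topology H V)"
  using assms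
  by (simp add: compact_group_def topological_group_wreath compact_space_prod_topology
      compact_space_product_topology Hausdorff_space_prod_topology Hausdorff_space_product_topology
      compact_space_discrete_topology)

lemma profinite_group_wreath:
  assumes B: "profinite_group B V" and H: "group H" "finite (carrier H)"
  shows "profinite_group (wreath_product B H) (wreath_topology H V)"
proof -
  have td: "totally_disconnected_space (product_topology (\<lambda>_. V) (carrier H))"
    using profinite_group_product[of "carrier H" "\<lambda>_. B" "\<lambda>_. V"] B by (simp add: profinite_group_def)
  have "\<exists>z. S \<subseteq> {z}" if S: "connectedin (wreath_topology H V) S" for S
  proof -
    obtain x where "fst ` S \<subseteq> {x}"
      using td connectedin_continuous_map_image[OF continuous_map_fst S]
      by (auto simp: totally_disconnected_space_def)
    moreover obtain h where "snd ` S \<subseteq> {h}"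
      using connectedin_continuous_map_image[OF continuous_map_snd S]
      by (auto simp: connectedin_discrete_topology)
    ultimately have "S \<subseteq> {(x, h)}" by force
    then show ?thesis by blast
  qed
  then show ?thesis
    using B H by (simp add: profinite_group_def compact_group_wreath totally_disconnected_space_def)
qed

text \<open>
  Each coordinate embedding \<open>\<Lambda> \<rightarrow> \<Lambda> \<wr> H\<close>, followed by \<open>\<kappa>\<close>, extends to a continuous map \<open>j a\<close> from \<open>B\<close> to
  \<open>K\<close>. The inverse of \<open>\<Phi>\<close> sends \<open>(y, h)\<close> to the product of the \<open>j a (y a)\<close>, in an arbitrary but fixed
  order, times \<open>\<kappa> (1, h)\<close>. The order is harmless: on the dense image of \<open>\<Lambda> \<wr> H\<close> the factors commute,
  and continuity of the product is all that is used elsewhere.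
\<close>

lemma wreath_completion_iso:
  assumes \<Lambda>: "group \<Lambda>" and H: "group H" "finite (carrier H)"
    and B: "compact_group B V" "\<beta> \<in> hom \<Lambda> B" "V closure_of (\<beta> ` carrier \<Lambda>) = carrier B"
    and K: "compact_group K U" "\<kappa> \<in> hom (wreath_product \<Lambda> H) K"
      "U closure_of (\<kappa> ` carrier (wreath_product \<Lambda> H)) = carrier K"
    and univB: "\<And>f. continuous_hom \<Lambda> (discrete_top \<Lambda>) K U f \<Longrightarrow>
      \<exists>\<phi>. continuous_hom B V K U \<phi> \<and> (\<forall>l\<in>carrier \<Lambda>. \<phi> (\<beta> l) = f l)"
    and univK: "\<And>f. continuous_hom (wreath_product \<Lambda> H) (discrete_top (wreath_product \<Lambda> H))
        (wreath_product B H) (wreath_topology H V) f \<Longrightarrow>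
      \<exists>\<phi>. continuous_hom K U (wreath_product B H) (wreath_topology H V) \<phi> \<and>
        (\<forall>g\<in>carrier (wreath_product \<Lambda> H). \<phi> (\<kappa> g) = f g)"
  shows "\<exists>\<Phi>. topological_iso K U (wreath_product B H) (wreath_topology H V) \<Phi>"
proof -
  let ?W = "wreath_product \<Lambda> H" and ?P = "product_topology (\<lambda>_. V) (carrier H)"
  let ?L = "wreath_product B H" and ?T = "wreath_topology H V"
  interpret \<Lambda>: group \<Lambda> by fact
  have tgK: "topological_group K U" and topK: "topspace U = carrier K" "Hausdorff_space U"
    using K(1) by (auto simp: compact_group_def topological_group_def)
  interpret K: group K using tgK by (simp add: topological_group_def)
  interpret W: group ?W using \<Lambda> H(1) by (rule group_wreath_product)
  interpret \<kappa>: group_hom ?W K \<kappa> using K(2) by unfold_locales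
  have gB: "group B" and topB: "topspace V = carrier B"
    using B(1) by (auto simp: compact_group_def topological_group_def)
  have "compact_group ?L ?T" by (rule compact_group_wreath[OF B(1) H])
  then have topL: "topspace ?T = carrier ?L" "Hausdorff_space ?T"
    unfolding compact_group_def topological_group_def by blast+
  have carW: "carrier ?W = (carrier H \<rightarrow>\<^sub>E carrier \<Lambda>) \<times> carrier H"
    using H(2) by (auto simp: wreath_carrier[OF \<Lambda>])
  define \<eta> where "\<eta> = wreath_map H \<beta>"
  have \<eta>: "\<eta> \<in> hom ?W ?L"
    unfolding \<eta>_def by (rule wreath_map_hom[OF \<Lambda> gB H(1) B(2)])
  then have "continuous_hom ?W (discrete_top ?W) ?L ?T \<eta>"
    unfolding continuous_hom_def using topL(1)
    by (simp add: hom_def del: topspace_prod_topology)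
  from univK[OF this] obtain \<Phi>
    where \<Phi>: "continuous_hom K U ?L ?T \<Phi>" "\<forall>g\<in>carrier ?W. \<Phi> (\<kappa> g) = \<eta> g"
    by blast
  have "(y, h) \<in> \<eta> ` carrier ?W" if y: "y \<in> carrier H \<rightarrow>\<^sub>E \<beta> ` carrier \<Lambda>" and h: "h \<in> carrier H" for y h
  proof (rule image_eqI)
    have yb: "y b \<in> \<beta> ` carrier \<Lambda>" if "b \<in> carrier H" for b using y that by auto
    show "(y, h) = \<eta> (\<lambda>b\<in>carrier H. inv_into (carrier \<Lambda>) \<beta> (y b), h)"
      using y by (auto simp: \<eta>_def wreath_map_def fun_eq_iff f_inv_into_f[OF yb] PiE_iff extensional_def)
    show "(\<lambda>b\<in>carrier H. inv_into (carrier \<Lambda>) \<beta> (y b), h) \<in> carrier ?W"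
      using h by (simp add: carW inv_into_into[OF yb])
  qed
  moreover have "\<eta> ` carrier ?W \<subseteq> (carrier H \<rightarrow>\<^sub>E \<beta> ` carrier \<Lambda>) \<times> carrier H"
    by (auto simp: carW \<eta>_def wreath_map_def)
  ultimately have "\<eta> ` carrier ?W = (carrier H \<rightarrow>\<^sub>E \<beta> ` carrier \<Lambda>) \<times> carrier H" by auto
  then have dense: "?T closure_of (\<eta> ` carrier ?W) = carrier ?L"
    using topL(1) topB closure_of_topspace[of "discrete_top H"]
    by (simp add: closure_of_Times closure_of_product_topology B(3))
  have "\<exists>j. continuous_map V U j \<and> (\<forall>l\<in>carrier \<Lambda>. j (\<beta> l) = \<kappa> (base_element \<Lambda> H {a} (\<lambda>_. l)))" for a
  proof -
    have "(\<lambda>l. \<kappa> (base_element \<Lambda> H {a} (\<lambda>_. l))) \<in> hom \<Lambda> K"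
      using hom_compose[OF coordinate_hom[OF \<Lambda> H(1)] K(2)] by (simp add: o_def)
    then have "continuous_hom \<Lambda> (discrete_top \<Lambda>) K U (\<lambda>l. \<kappa> (base_element \<Lambda> H {a} (\<lambda>_. l)))"
      using topK by (auto simp: continuous_hom_def hom_def)
    from univB[OF this] show ?thesis unfolding continuous_hom_def by blast
  qed
  then obtain j where j: "\<And>a. continuous_map V U (j a)"
    "\<And>a l. l \<in> carrier \<Lambda> \<Longrightarrow> j a (\<beta> l) = \<kappa> (base_element \<Lambda> H {a} (\<lambda>_. l))"
    by metis
  \<comment> \<open>The product of the \<open>j a (y a)\<close> for \<open>a \<in> F\<close>, built one factor at a time.\<close>
  have partial_product: "\<exists>\<psi>. continuous_map ?P U \<psi> \<and>
      (\<forall>x\<in>carrier H \<rightarrow>\<^sub>E carrier \<Lambda>. \<psi> (\<lambda>b\<in>carrier H. \<beta> (x b)) = \<kappa> (base_element \<Lambda> H F x))"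
    if "F \<subseteq> carrier H" for F
    using finite_subset[OF that H(2)] that
  proof (induction F rule: finite_induct)
    case empty
    have "base_element \<Lambda> H {} x = \<one>\<^bsub>?W\<^esub>" for x
      by (simp add: base_element_def wreath_one)
    then show ?case by (intro exI[of _ "\<lambda>_. \<one>\<^bsub>K\<^esub>"]) (simp add: topK)
  next
    case (insert a F)
    then have "F \<subseteq> carrier H" by simp
    from insert.IH[OF this] obtain \<psi> where \<psi>: "continuous_map ?P U \<psi>"
      "\<forall>x\<in>carrier H \<rightarrow>\<^sub>E carrier \<Lambda>. \<psi> (\<lambda>b\<in>carrier H. \<beta> (x b)) = \<kappa> (base_element \<Lambda> H F x)"
      by blast
    have a: "a \<in> carrier H" using insert.prems by simp
    have "continuous_map ?P U (\<lambda>y. j a (y a) \<otimes>\<^bsub>K\<^esub> \<psi> y)"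
      using continuous_map_compose[OF continuous_map_product_projection[OF a] j(1)[of a]] \<psi>(1)
      by (intro continuous_map_group_mult[OF tgK]) (auto simp: o_def)
    moreover have "j a ((\<lambda>b\<in>carrier H. \<beta> (x b)) a) \<otimes>\<^bsub>K\<^esub> \<psi> (\<lambda>b\<in>carrier H. \<beta> (x b)) = \<kappa> (base_element \<Lambda> H (insert a F) x)"
      if x: "x \<in> carrier H \<rightarrow>\<^sub>E carrier \<Lambda>" for x
    proof -
      have xc: "x b \<in> carrier \<Lambda>" if "b \<in> insert a F" for b
        using insert.prems x that by auto
      have "base_element \<Lambda> H {a} (\<lambda>_. x a) = base_element \<Lambda> H {a} x"
        by (auto simp: base_element_def fun_eq_iff)
      moreover have "base_element \<Lambda> H (insert a F) x = base_element \<Lambda> H {a} x \<otimes>\<^bsub>?W\<^esub> base_element \<Lambda> H F x"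
        using base_element_union[OF \<Lambda> H(1), of "{a}" F x] insert.hyps xc by simp
      moreover have "base_element \<Lambda> H {a} x \<in> carrier ?W" "base_element \<Lambda> H F x \<in> carrier ?W"
        using insert.hyps(1) xc by (intro base_element_closed[OF \<Lambda> H(1)]; simp)+
      ultimately show ?thesis
        using bspec[OF \<psi>(2) x] j(2)[of "x a" a] xc[of a] a by simp
    qed
    ultimately show ?case by (intro exI[of _ "\<lambda>y. j a (y a) \<otimes>\<^bsub>K\<^esub> \<psi> y"] conjI ballI)
  qed
  from partial_product[OF order_refl] obtain \<psi> where \<psi>: "continuous_map ?P U \<psi>"
    "\<forall>x\<in>carrier H \<rightarrow>\<^sub>E carrier \<Lambda>.
      \<psi> (\<lambda>b\<in>carrier H. \<beta> (x b)) = \<kappa> (base_element \<Lambda> H (carrier H) x)"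
    by (elim exE conjE)
  define \<Psi> where "\<Psi> = (\<lambda>z. \<psi> (fst z) \<otimes>\<^bsub>K\<^esub> \<kappa> (\<lambda>b\<in>carrier H. \<one>\<^bsub>\<Lambda>\<^esub>, snd z))"
  have "continuous_map ?T U \<Psi>"
    unfolding \<Psi>_def
  proof (rule continuous_map_prod_discrete)
    fix h assume "h \<in> carrier H"
    then have "\<kappa> (\<lambda>b\<in>carrier H. \<one>\<^bsub>\<Lambda>\<^esub>, h) \<in> carrier K"
      by (intro \<kappa>.hom_closed acting_element_closed[OF \<Lambda> H(1)])
    then show "continuous_map ?P U (\<lambda>y. \<psi> (fst (y, h)) \<otimes>\<^bsub>K\<^esub> \<kappa> (\<lambda>b\<in>carrier H. \<one>\<^bsub>\<Lambda>\<^esub>, snd (y, h)))"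
      using \<psi>(1) by (intro continuous_map_group_mult[OF tgK]) (simp_all add: topK)
  qed
  moreover have "\<Psi> (\<eta> g) = \<kappa> g" if g: "g \<in> carrier ?W" for g
  proof -
    obtain x h where xh: "g = (x, h)" by force
    then have x: "x \<in> carrier H \<rightarrow>\<^sub>E carrier \<Lambda>" "h \<in> carrier H" using g carW by auto
    have "\<Psi> (\<eta> g) = \<kappa> (base_element \<Lambda> H (carrier H) x) \<otimes>\<^bsub>K\<^esub> \<kappa> (\<lambda>b\<in>carrier H. \<one>\<^bsub>\<Lambda>\<^esub>, h)"
      using bspec[OF \<psi>(2) x(1)] by (simp add: \<Psi>_def \<eta>_def wreath_map_def xh)
    also have "\<dots> = \<kappa> (base_element \<Lambda> H (carrier H) x \<otimes>\<^bsub>?W\<^esub> (\<lambda>b\<in>carrier H. \<one>\<^bsub>\<Lambda>\<^esub>, h))"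
      using x by (intro \<kappa>.hom_mult[symmetric] base_element_closed[OF \<Lambda> H(1)] acting_element_closed[OF \<Lambda> H(1)] H(2)) auto
    also have "\<dots> = \<kappa> g"
      using wreath_decompose[OF \<Lambda> H(1), of x h "carrier H"] g by (simp add: xh)
    finally show ?thesis .
  qed
  ultimately have "topological_iso K U ?L ?T \<Phi>"
    using topK topL K(3) dense \<Phi>
    by (intro topological_iso_of_inverse_on_dense[where \<kappa> = \<kappa> and \<eta> = \<eta> and A = "carrier ?W" and \<psi> = \<Psi>]) auto
  then show ?thesis by blast
qed

section \<open>Completions of wreath products\<close>

theorem corollary6:
  fixes \<Lambda> :: "('a, 'm) monoid_scheme" and H :: "('h, 'q) monoid_scheme"
  assumes "group \<Lambda>" "countable (carrier \<Lambda>)"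
    and "group H" "countable (carrier H)"
  shows "(finite (carrier H) \<longrightarrow>
      (\<forall>(K :: ('k, 'n) monoid_scheme) U \<kappa> (B :: ('b, 'p) monoid_scheme) V \<beta>.
         bohr_compactification (wreath_product \<Lambda> H) (discrete_top (wreath_product \<Lambda> H)) K U \<kappa> \<and>
         bohr_compactification \<Lambda> (discrete_top \<Lambda>) B V \<beta> \<longrightarrow>
         (\<exists>\<Phi>. topological_iso K U
            (semidirect_product (sum_group (carrier H) (\<lambda>_. B)) H (shift_action H))
            (prod_topology (product_topology (\<lambda>_. V) (carrier H)) (discrete_top H)) \<Phi>)) \<and>
      (\<forall>(K :: ('k, 'n) monoid_scheme) U \<kappa> (P :: ('b, 'p) monoid_scheme) V \<alpha>.
         profinite_completion (wreath_product \<Lambda> H) (discrete_top (wreath_product \<Lambda> H)) K U \<kappa> \<and>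
         profinite_completion \<Lambda> (discrete_top \<Lambda>) P V \<alpha> \<longrightarrow>
         (\<exists>\<Phi>. topological_iso K U
            (semidirect_product (sum_group (carrier H) (\<lambda>_. P)) H (shift_action H))
            (prod_topology (product_topology (\<lambda>_. V) (carrier H)) (discrete_top H)) \<Phi>)))
    \<and>
    (infinite (carrier H) \<longrightarrow>
      (\<forall>(K\<^sub>1 :: ('k, 'n) monoid_scheme) U\<^sub>1 \<kappa>\<^sub>1 (K\<^sub>2 :: ('b, 'p) monoid_scheme) U\<^sub>2 \<kappa>\<^sub>2.
         bohr_compactification (wreath_product \<Lambda> H) (discrete_top (wreath_product \<Lambda> H)) K\<^sub>1 U\<^sub>1 \<kappa>\<^sub>1 \<and>
         bohr_compactification (wreath_product (abelianization \<Lambda>) H)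
           (discrete_top (wreath_product (abelianization \<Lambda>) H)) K\<^sub>2 U\<^sub>2 \<kappa>\<^sub>2 \<longrightarrow>
         (\<exists>\<phi>. induced_map (wreath_product \<Lambda> H) (wreath_abelianization_map \<Lambda> H)
                K\<^sub>1 U\<^sub>1 \<kappa>\<^sub>1 K\<^sub>2 U\<^sub>2 \<kappa>\<^sub>2 \<phi> \<and>
              topological_iso K\<^sub>1 U\<^sub>1 K\<^sub>2 U\<^sub>2 \<phi>)) \<and>
      (\<forall>(K\<^sub>1 :: ('k, 'n) monoid_scheme) U\<^sub>1 \<kappa>\<^sub>1 (K\<^sub>2 :: ('b, 'p) monoid_scheme) U\<^sub>2 \<kappa>\<^sub>2.
         profinite_completion (wreath_product \<Lambda> H) (discrete_top (wreath_product \<Lambda> H)) K\<^sub>1 U\<^sub>1 \<kappa>\<^sub>1 \<and>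
         profinite_completion (wreath_product (abelianization \<Lambda>) H)
           (discrete_top (wreath_product (abelianization \<Lambda>) H)) K\<^sub>2 U\<^sub>2 \<kappa>\<^sub>2 \<longrightarrow>
         (\<exists>\<phi>. induced_map (wreath_product \<Lambda> H) (wreath_abelianization_map \<Lambda> H)
                K\<^sub>1 U\<^sub>1 \<kappa>\<^sub>1 K\<^sub>2 U\<^sub>2 \<kappa>\<^sub>2 \<phi> \<and>
              topological_iso K\<^sub>1 U\<^sub>1 K\<^sub>2 U\<^sub>2 \<phi>)) \<and>
      (perfect_group \<Lambda> \<longrightarrow>
        (\<forall>(K\<^sub>1 :: ('k, 'n) monoid_scheme) U\<^sub>1 \<kappa>\<^sub>1 (K\<^sub>2 :: ('b, 'p) monoid_scheme) U\<^sub>2 \<kappa>\<^sub>2.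
           bohr_compactification (wreath_product \<Lambda> H) (discrete_top (wreath_product \<Lambda> H)) K\<^sub>1 U\<^sub>1 \<kappa>\<^sub>1 \<and>
           bohr_compactification H (discrete_top H) K\<^sub>2 U\<^sub>2 \<kappa>\<^sub>2 \<longrightarrow>
           (\<exists>\<phi>. induced_map (wreath_product \<Lambda> H) snd K\<^sub>1 U\<^sub>1 \<kappa>\<^sub>1 K\<^sub>2 U\<^sub>2 \<kappa>\<^sub>2 \<phi> \<and>
                topological_iso K\<^sub>1 U\<^sub>1 K\<^sub>2 U\<^sub>2 \<phi>)) \<and>
        (\<forall>(K\<^sub>1 :: ('k, 'n) monoid_scheme) U\<^sub>1 \<kappa>\<^sub>1 (K\<^sub>2 :: ('b, 'p) monoid_scheme) U\<^sub>2 \<kappa>\<^sub>2.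
           profinite_completion (wreath_product \<Lambda> H) (discrete_top (wreath_product \<Lambda> H)) K\<^sub>1 U\<^sub>1 \<kappa>\<^sub>1 \<and>
           profinite_completion H (discrete_top H) K\<^sub>2 U\<^sub>2 \<kappa>\<^sub>2 \<longrightarrow>
           (\<exists>\<phi>. induced_map (wreath_product \<Lambda> H) snd K\<^sub>1 U\<^sub>1 \<kappa>\<^sub>1 K\<^sub>2 U\<^sub>2 \<kappa>\<^sub>2 \<phi> \<and>
                topological_iso K\<^sub>1 U\<^sub>1 K\<^sub>2 U\<^sub>2 \<phi>))))"
proof (intro conjI impI allI)
  assume fin: "finite (carrier H)"
  fix K :: "('k, 'n) monoid_scheme" and U \<kappa> and B :: "('b, 'p) monoid_scheme" and V \<beta>
  assume "bohr_compactification (wreath_product \<Lambda> H) (discrete_top (wreath_product \<Lambda> H)) K U \<kappa> \<and>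
    bohr_compactification \<Lambda> (discrete_top \<Lambda>) B V \<beta>"
  then have KB: "bohr_compactification (wreath_product \<Lambda> H) (discrete_top (wreath_product \<Lambda> H)) K U \<kappa>"
    "bohr_compactification \<Lambda> (discrete_top \<Lambda>) B V \<beta>" by auto
  then have cK: "compact_group K U" "\<kappa> \<in> hom (wreath_product \<Lambda> H) K"
      "U closure_of (\<kappa> ` carrier (wreath_product \<Lambda> H)) = carrier K"
    and cB: "compact_group B V" "\<beta> \<in> hom \<Lambda> B" "V closure_of (\<beta> ` carrier \<Lambda>) = carrier B"
    unfolding bohr_compactification_def continuous_hom_def by simp_all
  show "\<exists>\<Phi>. topological_iso K U (semidirect_product (sum_group (carrier H) (\<lambda>_. B)) H (shift_action H))
      (wreath_topology H V) \<Phi>"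
    unfolding wreath_product_def[symmetric]
    by (rule wreath_completion_iso[OF assms(1,3) fin cB cK
          bohr_compactification_universal[OF KB(2) cK(1)]
          bohr_compactification_universal[OF KB(1) compact_group_wreath[OF cB(1) assms(3) fin]]])
next
  assume fin: "finite (carrier H)"
  fix K :: "('k, 'n) monoid_scheme" and U \<kappa> and P :: "('b, 'p) monoid_scheme" and V \<alpha>
  assume "profinite_completion (wreath_product \<Lambda> H) (discrete_top (wreath_product \<Lambda> H)) K U \<kappa> \<and>
    profinite_completion \<Lambda> (discrete_top \<Lambda>) P V \<alpha>"
  then have KP: "profinite_completion (wreath_product \<Lambda> H) (discrete_top (wreath_product \<Lambda> H)) K U \<kappa>"
    "profinite_completion \<Lambda> (discrete_top \<Lambda>) P V \<alpha>" by auto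
  then have pK: "profinite_group K U" and pP: "profinite_group P V"
    and cK: "compact_group K U" "\<kappa> \<in> hom (wreath_product \<Lambda> H) K"
      "U closure_of (\<kappa> ` carrier (wreath_product \<Lambda> H)) = carrier K"
    and cP: "compact_group P V" "\<alpha> \<in> hom \<Lambda> P" "V closure_of (\<alpha> ` carrier \<Lambda>) = carrier P"
    unfolding profinite_completion_def continuous_hom_def profinite_group_def by simp_all
  show "\<exists>\<Phi>. topological_iso K U (semidirect_product (sum_group (carrier H) (\<lambda>_. P)) H (shift_action H))
      (wreath_topology H V) \<Phi>"
    unfolding wreath_product_def[symmetric]
    by (rule wreath_completion_iso[OF assms(1,3) fin cP cK
          profinite_completion_universal[OF KP(2) pK]
          profinite_completion_universal[OF KP(1) profinite_group_wreath[OF pP assms(3) fin]]])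
next
  note q = wreath_abelianization_map[OF assms(1,3)]
  note die = commutator_families_die[OF assms(1,3)]
  assume inf: "infinite (carrier H)"
  have collapse: "\<kappa> g = \<one>\<^bsub>K\<^esub>"
    if "compact_group K U" "\<kappa> \<in> hom (wreath_product \<Lambda> H) K" "g \<in> carrier (wreath_product \<Lambda> H)"
      "wreath_abelianization_map \<Lambda> H g = \<one>\<^bsub>wreath_product (abelianization \<Lambda>) H\<^esub>"
    for K :: "('k, 'n) monoid_scheme" and U \<kappa> g
    using q(3)[of "fst g" "snd g"] die[OF inf that(1,2), of "fst g"] that(3,4) by (cases g) simp
  {
    fix K\<^sub>1 :: "('k, 'n) monoid_scheme" and U\<^sub>1 \<kappa>\<^sub>1 and K\<^sub>2 :: "('b, 'p) monoid_scheme" and U\<^sub>2 \<kappa>\<^sub>2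
    assume KK: "bohr_compactification (wreath_product \<Lambda> H) (discrete_top (wreath_product \<Lambda> H)) K\<^sub>1 U\<^sub>1 \<kappa>\<^sub>1 \<and>
      bohr_compactification (wreath_product (abelianization \<Lambda>) H)
        (discrete_top (wreath_product (abelianization \<Lambda>) H)) K\<^sub>2 U\<^sub>2 \<kappa>\<^sub>2"
    then have "compact_group K\<^sub>1 U\<^sub>1" "\<kappa>\<^sub>1 \<in> hom (wreath_product \<Lambda> H) K\<^sub>1"
      by (simp_all add: bohr_compactification_def continuous_hom_def)
    from bohr_iso_of_quotient[OF conjunct1[OF KK] conjunct2[OF KK] q(1,2) collapse[OF this]]
    show "\<exists>\<phi>. induced_map (wreath_product \<Lambda> H) (wreath_abelianization_map \<Lambda> H)
        K\<^sub>1 U\<^sub>1 \<kappa>\<^sub>1 K\<^sub>2 U\<^sub>2 \<kappa>\<^sub>2 \<phi> \<and> topological_iso K\<^sub>1 U\<^sub>1 K\<^sub>2 U\<^sub>2 \<phi>" .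
  next
    fix K\<^sub>1 :: "('k, 'n) monoid_scheme" and U\<^sub>1 \<kappa>\<^sub>1 and K\<^sub>2 :: "('b, 'p) monoid_scheme" and U\<^sub>2 \<kappa>\<^sub>2
    assume KK: "profinite_completion (wreath_product \<Lambda> H) (discrete_top (wreath_product \<Lambda> H)) K\<^sub>1 U\<^sub>1 \<kappa>\<^sub>1 \<and>
      profinite_completion (wreath_product (abelianization \<Lambda>) H)
        (discrete_top (wreath_product (abelianization \<Lambda>) H)) K\<^sub>2 U\<^sub>2 \<kappa>\<^sub>2"
    then have "compact_group K\<^sub>1 U\<^sub>1" "\<kappa>\<^sub>1 \<in> hom (wreath_product \<Lambda> H) K\<^sub>1"
      by (simp_all add: profinite_completion_def profinite_group_def continuous_hom_def)
    from profinite_iso_of_quotient[OF conjunct1[OF KK] conjunct2[OF KK] q(1,2) collapse[OF this]]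
    show "\<exists>\<phi>. induced_map (wreath_product \<Lambda> H) (wreath_abelianization_map \<Lambda> H)
        K\<^sub>1 U\<^sub>1 \<kappa>\<^sub>1 K\<^sub>2 U\<^sub>2 \<kappa>\<^sub>2 \<phi> \<and> topological_iso K\<^sub>1 U\<^sub>1 K\<^sub>2 U\<^sub>2 \<phi>" .
  next
    assume perfect: "perfect_group \<Lambda>"
    have collapse: "\<kappa> g = \<one>\<^bsub>K\<^esub>"
      if K: "compact_group K U" and \<kappa>: "\<kappa> \<in> hom (wreath_product \<Lambda> H) K"
        and mem: "g \<in> carrier (wreath_product \<Lambda> H)" and ker: "snd g = \<one>\<^bsub>H\<^esub>"
      for K :: "('k, 'n) monoid_scheme" and U \<kappa> g
    proof -
      obtain x where g: "g = (x, \<one>\<^bsub>H\<^esub>)" using ker by (cases g) auto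
      have "x b \<in> commutator_subgroup \<Lambda>" if "b \<in> carrier H" for b
        using that mem perfect by (auto simp: g wreath_carrier[OF assms(1)] perfect_group_def)
      then show ?thesis using die[OF inf K \<kappa>, of x] mem by (simp add: g)
    qed
    {
      fix K\<^sub>1 :: "('k, 'n) monoid_scheme" and U\<^sub>1 \<kappa>\<^sub>1 and K\<^sub>2 :: "('b, 'p) monoid_scheme" and U\<^sub>2 \<kappa>\<^sub>2
      assume KK: "bohr_compactification (wreath_product \<Lambda> H) (discrete_top (wreath_product \<Lambda> H)) K\<^sub>1 U\<^sub>1 \<kappa>\<^sub>1 \<and>
        bohr_compactification H (discrete_top H) K\<^sub>2 U\<^sub>2 \<kappa>\<^sub>2"
      then have "compact_group K\<^sub>1 U\<^sub>1" "\<kappa>\<^sub>1 \<in> hom (wreath_product \<Lambda> H) K\<^sub>1"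
        by (simp_all add: bohr_compactification_def continuous_hom_def)
      from bohr_iso_of_quotient[OF conjunct1[OF KK] conjunct2[OF KK] wreath_snd[OF assms(1,3)] collapse[OF this]]
      show "\<exists>\<phi>. induced_map (wreath_product \<Lambda> H) snd K\<^sub>1 U\<^sub>1 \<kappa>\<^sub>1 K\<^sub>2 U\<^sub>2 \<kappa>\<^sub>2 \<phi> \<and>
        topological_iso K\<^sub>1 U\<^sub>1 K\<^sub>2 U\<^sub>2 \<phi>" .
    next
      fix K\<^sub>1 :: "('k, 'n) monoid_scheme" and U\<^sub>1 \<kappa>\<^sub>1 and K\<^sub>2 :: "('b, 'p) monoid_scheme" and U\<^sub>2 \<kappa>\<^sub>2
      assume KK: "profinite_completion (wreath_product \<Lambda> H) (discrete_top (wreath_product \<Lambda> H)) K\<^sub>1 U\<^sub>1 \<kappa>\<^sub>1 \<and>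
        profinite_completion H (discrete_top H) K\<^sub>2 U\<^sub>2 \<kappa>\<^sub>2"
      then have "compact_group K\<^sub>1 U\<^sub>1" "\<kappa>\<^sub>1 \<in> hom (wreath_product \<Lambda> H) K\<^sub>1"
        by (simp_all add: profinite_completion_def profinite_group_def continuous_hom_def)
      from profinite_iso_of_quotient[OF conjunct1[OF KK] conjunct2[OF KK] wreath_snd[OF assms(1,3)] collapse[OF this]]
      show "\<exists>\<phi>. induced_map (wreath_product \<Lambda> H) snd K\<^sub>1 U\<^sub>1 \<kappa>\<^sub>1 K\<^sub>2 U\<^sub>2 \<kappa>\<^sub>2 \<phi> \<and>
        topological_iso K\<^sub>1 U\<^sub>1 K\<^sub>2 U\<^sub>2 \<phi>" .
    }
  }
qed

end
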